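(* Let $$\mathcal S=\Big\{(x,n)\in\mathcal X\times\mathcal N:\ 0\in\partial_n\big(F(x,\cdot)+i_{\mathcal N}\big)(n),\ x\in\arg\min_{z\in\mathcal X}F(z,n)\Big\},$$ $$\mathcal S_M=\Big\{(x,n)\in\mathcal X\times\mathcal N:\ 0\in\partial_n\big(F_M(x,\cdot)+i_{\mathcal N}\big)(n),\ x\in\arg\min_{z\in\mathcal X}F_M(z,n)\Big\}.$$ Then, with probability $1$: (a) every sequence $(x_M,n_M)\in\mathcal S_M$ admits a subsequence converging to some $(x^*,n^* )\in\mathcal S$, and $\sup_{(x,n)\in\mathcal S_M}\operatorname{dist}\big((x,n),\mathcal S\big)\to0$ as $M\to\infty$; (b) if, moreover, for every $(x^*,n^* )\in\mathcal S$, $x^*$ is the unique minimizer of $F(\cdot,n^* )$ over $\mathcal X$, then the Hausdorff distance satisfies $d_H(\mathcal S_M,\mathcal S)\to0$ as $M\to\infty$. (c) If for every $(x_M,n_M)\in\mathcal S_M$ the function $F_M(x_M,\cdot)$ satisfies a local quadratic growth condition at $n_M$ on $\mathcal N$, then $\mathcal S$ and $\mathcal S_M$ are the sets of local minimizers of $F$ and $F_M$, respectively.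
   Context: $\mathcal I,\mathcal J$ are finite index sets, $b>0$, $\mathcal X=\{x\in\{0,1\}^{|\mathcal I|}:\sum_{i\in\mathcal I} x_i\le p\}$, $\mathcal N=[0,b]^{|\mathcal J|}$. Define $$F(x,n)=e+d^\top n+r^\top x+\sum_{j\in\mathcal J}h_j(n_j;\sigma_j)\sum_{i\in\mathcal I}q_{ij}\Psi\!\left(\frac{g_{ij}(x)}{h_j(n_j;\sigma_j)}\right),$$ $$F_M(x,n)=e+d^\top n+r^\top x+\frac1M\sum_{t=1}^M\sum_{j\in\mathcal J}h_j(n_j;\sigma_j)\sum_{i\in\mathcal I}q_{ij}\left(\zeta^t+\frac{g_{ij}(x)}{h_j(n_j;\sigma_j)}\right)_+,$$ where $\Psi(z)=z\Phi(z)+\phi(z)$ with $\Phi,\phi$ the standard normal cdf and pdf, $(a)_+=\max\{0,a\}$, $\zeta^1,\zeta^2,\dots$ are i.i.d. $N(0,1)$, $e\in\mathbb R$, $d\in\mathbb R^{|\mathcal J|}$ (sampling costs), $r\in\mathbb R^{|\mathcal I|}$, $q_{ij}>0$, and each $g_{ij}$ is an affine function of $x$. The functions $h_j$ satisfy: (i) $h_j(\cdot;\sigma_j)$ is finite, positive, strictly convex, decreasing and continuously differentiable on $[0,\infty)$ for any $\sigma_j$; (ii) $\frac{\partial h_j}{\partial\sigma_j}(n_j;\sigma_j)>0$ for all $n_j\ge0$; (iii) $\frac{\partial^2h_j}{\partial n_j\partial\sigma_j}(n_j;\sigma_j)<0$ for all $n_j\ge0$. $i_{\mathcal N}$ is the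 indicator function ($0$ on $\mathcal N$, $+\infty$ off $\mathcal N$). $\partial$ is the limiting subdifferential: $v\in\partial f(x)$ iff there are $x^k\to x$ with $f(x^k)\to f(x)$ and $v^k\to v$ with $v^k\in\widehat\partial f(x^k)$, where $\widehat\partial f(x)$ (Fréchet subdifferential, for $f(x)<\infty$; empty otherwise) is the set of $v$ with $\liminf_{y\to x,\,y\ne x}\frac{f(y)-f(x)-\langle v,y-x\rangle}{\|x-y\|}\ge0$. $d_H(A,B)=\max\{\sup_{b\in B}\operatorname{dist}(b,A),\sup_{a\in A}\operatorname{dist}(a,B)\}$. Local quadratic growth of $G$ at $\bar n$ on $\mathcal N$: there exist $\varepsilon>0$, $c>0$ with $G(n)\ge G(\bar n)+\frac c2\|n-\bar n\|^2$ for all $n\in\mathcal N$ with $\|n-\bar n\|<\varepsilon$. A (blockwise) local minimizer of $H\in\{F,F_M\}$ is a point $(x^*,n^* )\in\mathcal X\times\mathcal N$ with $x^*\in\arg\min_{x\in\mathcal X}H(x,n^* )$ and, for some $\epsilon>0$, $H(x^*,n^* )\le H(x^*,n)$ for all $n\in\mathcal N$ with $\|n-n^*\|<\epsilon$. *)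

theory Defs
  imports "HOL-Probability.Probability"
begin

text \<open>
  The index sets are the universes of two types of class \<^class>\<open>finite\<close>, written 'i and 'j.
  Decision pairs live in the product of two Euclidean spaces, whose library distance is the
  Euclidean one.
\<close>

definition binary_budget_set :: "real \<Rightarrow> (real ^ 'i::finite) set" where
  "binary_budget_set p = {x. (\<forall>i. x $ i \<in> {0, 1}) \<and> (\<Sum>i\<in>UNIV. x $ i) \<le> p}"

definition box_set :: "real \<Rightarrow> (real ^ 'j::finite) set" where
  "box_set b = {n. \<forall>j. 0 \<le> n $ j \<and> n $ j \<le> b}"

definition is_affine_function :: "('a::real_vector \<Rightarrow> real) \<Rightarrow> bool" where
  "is_affine_function f \<longleftrightarrow> (\<exists>l c. linear l \<and> (\<forall>x. f x = l x + c))"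

definition strictly_convex_on :: "'a::real_vector set \<Rightarrow> ('a \<Rightarrow> real) \<Rightarrow> bool" where
  "strictly_convex_on A f \<longleftrightarrow> convex A \<and>
     (\<forall>x\<in>A. \<forall>y\<in>A. \<forall>u. x \<noteq> y \<longrightarrow> 0 < u \<longrightarrow> u < 1 \<longrightarrow>
        f ((1 - u) *\<^sub>R x + u *\<^sub>R y) < (1 - u) * f x + u * f y)"

text \<open>
  \<open>h n s\<close> stands for $h(n; s)$, and \<open>Sig\<close> is the range of admissible parameters \<open>s\<close>.
  Derivatives in \<open>n\<close> are relative to the half-line, hence one-sided at 0.
\<close>

definition noise_function :: "real set \<Rightarrow> (real \<Rightarrow> real \<Rightarrow> real) \<Rightarrow> bool" where
  "noise_function Sig h \<longleftrightarrow>
     (\<forall>s\<in>Sig.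
        (\<forall>n\<ge>0. h n s > 0) \<and>
        strictly_convex_on {0..} (\<lambda>n. h n s) \<and>
        antimono_on {0..} (\<lambda>n. h n s) \<and>
        (\<exists>h'. continuous_on {0..} h' \<and>
           (\<forall>n\<ge>0. ((\<lambda>n. h n s) has_real_derivative h' n) (at n within {0..}))) \<and>
        (\<exists>hs hns. \<forall>n\<ge>0.
           ((\<lambda>s. h n s) has_real_derivative hs n) (at s) \<and> hs n > 0 \<and>
           (hs has_real_derivative hns n) (at n within {0..}) \<and> hns n < 0))"

definition std_normal_cdf :: "real \<Rightarrow> real" where
  "std_normal_cdf = cdf std_normal_distribution"

definition Psi :: "real \<Rightarrow> real" where
  "Psi z = z * std_normal_cdf z + std_normal_density z"

definition true_objective ::
  "real \<Rightarrow> real ^ 'j::finite \<Rightarrow> real ^ 'i::finite \<Rightarrow> ('i \<Rightarrow> 'j \<Rightarrow> real) \<Rightarrow>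
   ('i \<Rightarrow> 'j \<Rightarrow> real ^ 'i \<Rightarrow> real) \<Rightarrow> ('j \<Rightarrow> real \<Rightarrow> real \<Rightarrow> real) \<Rightarrow> ('j \<Rightarrow> real) \<Rightarrow>
   real ^ 'i \<Rightarrow> real ^ 'j \<Rightarrow> real" where
  "true_objective e d r q g h \<sigma> x n =
     e + d \<bullet> n + r \<bullet> x +
     (\<Sum>j\<in>UNIV. h j (n $ j) (\<sigma> j) *
        (\<Sum>i\<in>UNIV. q i j * Psi (g i j x / h j (n $ j) (\<sigma> j))))"

definition sample_objective ::
  "real \<Rightarrow> real ^ 'j::finite \<Rightarrow> real ^ 'i::finite \<Rightarrow> ('i \<Rightarrow> 'j \<Rightarrow> real) \<Rightarrow>
   ('i \<Rightarrow> 'j \<Rightarrow> real ^ 'i \<Rightarrow> real) \<Rightarrow> ('j \<Rightarrow> real \<Rightarrow> real \<Rightarrow> real) \<Rightarrow> ('j \<Rightarrow> real) \<Rightarrow>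
   (nat \<Rightarrow> real) \<Rightarrow> nat \<Rightarrow> real ^ 'i \<Rightarrow> real ^ 'j \<Rightarrow> real" where
  "sample_objective e d r q g h \<sigma> z M x n =
     e + d \<bullet> n + r \<bullet> x +
     1 / real M * (\<Sum>t=1..M. \<Sum>j\<in>UNIV. h j (n $ j) (\<sigma> j) *
        (\<Sum>i\<in>UNIV. q i j * max 0 (z t + g i j x / h j (n $ j) (\<sigma> j))))"

definition indicator_ext :: "'a set \<Rightarrow> 'a \<Rightarrow> ereal" where
  "indicator_ext A x = (if x \<in> A then 0 else \<infinity>)"

text \<open>Subdifferentials are meant for functions that never take the value \<open>-\<infinity>\<close>.\<close>

definition frechet_subdiff :: "('a::real_inner \<Rightarrow> ereal) \<Rightarrow> 'a \<Rightarrow> 'a set" where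
  "frechet_subdiff f x =
     {v. f x < \<infinity> \<and>
         Liminf (at x) (\<lambda>y. (f y - f x - ereal (v \<bullet> (y - x))) / ereal (norm (x - y))) \<ge> 0}"

definition limiting_subdiff :: "('a::real_inner \<Rightarrow> ereal) \<Rightarrow> 'a \<Rightarrow> 'a set" where
  "limiting_subdiff f x =
     {v. \<exists>xs vs. xs \<longlonglongrightarrow> x \<and> (\<lambda>k. f (xs k)) \<longlonglongrightarrow> f x \<and> vs \<longlonglongrightarrow> v \<and>
           (\<forall>k. vs k \<in> frechet_subdiff f (xs k))}"

definition stationary_set ::
  "'a set \<Rightarrow> 'b::real_inner set \<Rightarrow> ('a \<Rightarrow> 'b \<Rightarrow> real) \<Rightarrow> ('a \<times> 'b) set" where
  "stationary_set X N H =
     {(x, n). x \<in> X \<and> n \<in> N \<and>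
        0 \<in> limiting_subdiff (\<lambda>m. ereal (H x m) + indicator_ext N m) n \<and>
        is_arg_min (\<lambda>z. H z n) (\<lambda>z. z \<in> X) x}"

definition block_local_minimizers ::
  "'a set \<Rightarrow> 'b::real_normed_vector set \<Rightarrow> ('a \<Rightarrow> 'b \<Rightarrow> real) \<Rightarrow> ('a \<times> 'b) set" where
  "block_local_minimizers X N H =
     {(x, n). x \<in> X \<and> n \<in> N \<and>
        is_arg_min (\<lambda>z. H z n) (\<lambda>z. z \<in> X) x \<and>
        (\<exists>\<epsilon>>0. \<forall>m\<in>N. norm (m - n) < \<epsilon> \<longrightarrow> H x n \<le> H x m)}"

definition local_quadratic_growth ::
  "'b::real_normed_vector set \<Rightarrow> ('b \<Rightarrow> real) \<Rightarrow> 'b \<Rightarrow> bool" where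
  "local_quadratic_growth N G n0 \<longleftrightarrow>
     (\<exists>\<epsilon>>0. \<exists>c>0. \<forall>n\<in>N. norm (n - n0) < \<epsilon> \<longrightarrow>
        G n \<ge> G n0 + c / 2 * (norm (n - n0))\<^sup>2)"

text \<open>
  Distances to sets are taken in \<^typ>\<open>ennreal\<close> rather than with \<^const>\<open>infdist\<close>, so that the
  distance to the empty set is \<open>\<infinity>\<close> and the suprema below need no boundedness.
\<close>

definition dist_to_set :: "'a::metric_space \<Rightarrow> 'a set \<Rightarrow> ennreal" where
  "dist_to_set a B = (INF b\<in>B. ennreal (dist a b))"

definition excess_dist :: "'a::metric_space set \<Rightarrow> 'a set \<Rightarrow> ennreal" where
  "excess_dist A B = (SUP a\<in>A. dist_to_set a B)"

definition hausdorff_distance :: "'a::metric_space set \<Rightarrow> 'a set \<Rightarrow> ennreal" where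
  "hausdorff_distance A B = max (excess_dist B A) (excess_dist A B)"

end

theory Submission
  imports Defs "HOL-Library.Discrete_Functions" "HOL-Real_Asymp.Real_Asymp"
begin

text \<open>
  The two objectives differ only in their loss function: $F_M$ is $F$ with $\Psi$ replaced by the
  empirical loss $\Psi_M(a) = \frac1M \sum_t (\zeta^t + a)_+$. Since $E(\zeta + a)_+ = \Psi(a)$
  (\<open>expectation_positive_part_std_normal\<close>), a strong law of large numbers gives
  $\Psi_M(a) \to \Psi(a)$ almost surely for all rational $a$ at once. All $\Psi_M$ are 1-Lipschitz, so on
  the same event $\Psi_M(a_M) \to \Psi(a)$ whenever $a_M \to a$. Everything else is deterministic and
  happens on this event.
  
  $F_M(x, \cdot)$ is in general neither convex nor smooth. It is separable, however, and in the
  coordinate $y = h_j(n_j)$ its $j$-th loss term $c_j(y) = y \sum_i q_{ij} \Psi_M(g_{ij}(x) / y)$ is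
  convex, being a sum of perspectives of a convex function, while $h_j$ is continuously differentiable
  with negative derivative. A limiting stationary point $n$ therefore satisfies, for all $m \in [0,b]$,
  \[ \frac{d_j}{h_j'(n_j)} (h_j(m) - h_j(n_j)) + c_j(h_j(m)) - c_j(h_j(n_j)) \ge 0 \]
  (\<open>frechet_imp_critical\<close>, \<open>stationary_imp_critical\<close>). No subgradients occur in this inequality,
  so it survives the passage from $\Psi_M$ to $\Psi$ (\<open>critical_limit\<close>).
  
  For $\Psi$ itself, $\Psi(z) - z \Psi'(z) = \phi(z) > 0$ makes $c_j$ increasing, so $F(x, \cdot)$ is
  strictly convex on $\mathcal N$ and the inequality characterizes its unique minimizer
  (\<open>critical_imp_strict_minimizer\<close>). Compactness of $\mathcal X \times \mathcal N$ then yields (a)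
  (\<open>stationary_cluster\<close>).
  
  For (b), $\mathcal S$ is finite, because each $x$ carries at most one $n$. Given
  $(x^*, n^*) \in \mathcal S$, minimizers $n_M$ of $F_M(x^*, \cdot)$ converge to $n^*$, and the finitely
  many competitors of $x^*$, strictly worse at $n^*$, stay worse at $n_M$; so
  $(x^*, n_M) \in \mathcal S_M$ for large $M$ (\<open>excess_stationary_limit_tendsto_0\<close>).
  
  For (c), local minimizers are always stationary; the converse is convexity in the case of $F$, and
  quadratic growth in the case of $F_M$.
\<close>

section \<open>A strong law of large numbers\<close>

text \<open>
  Independent centered variables are orthogonal in $L^2$, so second moments add up.
\<close>

lemma (in prob_space) second_moment_sum_indep_centered:
  fixes Z :: "'i \<Rightarrow> 'a \<Rightarrow> real" and V :: real
  assumes "finite A" "indep_vars (\<lambda>_. borel) Z A"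
    and "\<And>t. t \<in> A \<Longrightarrow> integrable M (\<lambda>\<omega>. (Z t \<omega>)\<^sup>2)"
    and "\<And>t. t \<in> A \<Longrightarrow> expectation (Z t) = 0"
    and "\<And>t. t \<in> A \<Longrightarrow> expectation (\<lambda>\<omega>. (Z t \<omega>)\<^sup>2) \<le> V"
  shows "integrable M (\<lambda>\<omega>. (\<Sum>t\<in>A. Z t \<omega>)\<^sup>2) \<and>
    expectation (\<lambda>\<omega>. (\<Sum>t\<in>A. Z t \<omega>)\<^sup>2) \<le> card A * V"
  using assms
proof (induction A rule: finite_induct)
  case empty
  then show ?case by simp
next
  case (insert a A)
  let ?S = "\<lambda>\<omega>. \<Sum>t\<in>A. Z t \<omega>"
  have rv: "Z t \<in> borel_measurable M" if "t \<in> insert a A" for t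
    using insert.prems(1) that by (auto simp: indep_vars_def2)
  have int: "integrable M (Z t)" if "t \<in> insert a A" for t
    by (rule square_integrable_imp_integrable) (use rv insert.prems(2) that in auto)
  have intS: "integrable M ?S"
    using int by (intro Bochner_Integration.integrable_sum) auto
  have IH: "integrable M (\<lambda>\<omega>. (?S \<omega>)\<^sup>2)" "expectation (\<lambda>\<omega>. (?S \<omega>)\<^sup>2) \<le> card A * V"
    using insert.IH indep_vars_subset[OF insert.prems(1)] insert.prems by blast+
  have ind: "indep_var borel (Z a) borel ?S"
    by (rule indep_vars_sum) (use insert in auto)
  have cross_int: "integrable M (\<lambda>\<omega>. Z a \<omega> * ?S \<omega>)"
    by (rule indep_var_integrable[OF ind]) (use int intS in auto)
  have cross: "expectation (\<lambda>\<omega>. Z a \<omega> * ?S \<omega>) = 0"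
    using indep_var_lebesgue_integral[OF ind] int intS insert.prems(3)[of a] by simp
  have expand: "(\<Sum>t\<in>insert a A. Z t \<omega>)\<^sup>2 = (Z a \<omega>)\<^sup>2 + 2 * (Z a \<omega> * ?S \<omega>) + (?S \<omega>)\<^sup>2" for \<omega>
    using insert.hyps by (simp add: power2_sum)
  have inta: "integrable M (\<lambda>\<omega>. (Z a \<omega>)\<^sup>2)"
    using insert.prems(2) by auto
  have "expectation (\<lambda>\<omega>. (\<Sum>t\<in>insert a A. Z t \<omega>)\<^sup>2) =
      expectation (\<lambda>\<omega>. (Z a \<omega>)\<^sup>2) + expectation (\<lambda>\<omega>. (?S \<omega>)\<^sup>2)"
    unfolding expand using inta IH(1) cross_int cross by simp
  also have "\<dots> \<le> V + card A * V"
    using insert.prems(4)[of a] IH(2) by (intro add_mono) auto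
  also have "\<dots> = card (insert a A) * V"
    using insert.hyps by (simp add: algebra_simps)
  finally show ?case
    unfolding expand using inta IH(1) cross_int by auto
qed

text \<open>
  For $k^2 \le n \le (k+1)^2$ monotonicity squeezes $s_n / n$ between $s_{k^2} / (k+1)^2$ and
  $s_{(k+1)^2} / k^2$, and the ratio of the two denominators tends to 1.
\<close>

lemma averages_tendsto_from_squares:
  fixes s :: "nat \<Rightarrow> real"
  assumes mono: "\<And>k l. k \<le> l \<Longrightarrow> s k \<le> s l" and nonneg: "\<And>k. 0 \<le> s k"
    and lim: "(\<lambda>k. s (k\<^sup>2) / real (k\<^sup>2)) \<longlonglongrightarrow> \<mu>"
  shows "(\<lambda>n. s n / real n) \<longlonglongrightarrow> \<mu>"
proof -
  let ?a = "\<lambda>k. s (k\<^sup>2) / real (k\<^sup>2)"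
  have sqrt_top: "filterlim floor_sqrt at_top sequentially"
    unfolding filterlim_at_top
    by (metis eventually_sequentiallyI le_floor_sqrt_iff)
  have r1: "(\<lambda>k. real (k\<^sup>2) / real ((Suc k)\<^sup>2)) \<longlonglongrightarrow> 1"
    by real_asymp
  have r2: "(\<lambda>k. real ((Suc k)\<^sup>2) / real (k\<^sup>2)) \<longlonglongrightarrow> 1"
    by real_asymp
  have "(\<lambda>k. ?a k * (real (k\<^sup>2) / real ((Suc k)\<^sup>2))) \<longlonglongrightarrow> \<mu> * 1"
    by (intro tendsto_mult lim r1)
  from filterlim_compose[OF this sqrt_top]
  have lower: "(\<lambda>n. ?a (floor_sqrt n) * (real ((floor_sqrt n)\<^sup>2) / real ((Suc (floor_sqrt n))\<^sup>2)))
      \<longlonglongrightarrow> \<mu>" by simp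
  have "(\<lambda>k. ?a (Suc k) * (real ((Suc k)\<^sup>2) / real (k\<^sup>2))) \<longlonglongrightarrow> \<mu> * 1"
    by (intro tendsto_mult r2 LIMSEQ_Suc[OF lim])
  from filterlim_compose[OF this sqrt_top]
  have upper: "(\<lambda>n. ?a (Suc (floor_sqrt n)) * (real ((Suc (floor_sqrt n))\<^sup>2) / real ((floor_sqrt n)\<^sup>2)))
      \<longlonglongrightarrow> \<mu>" by simp
  show ?thesis
  proof (rule tendsto_sandwich[OF _ _ lower upper]; rule eventually_mono[OF eventually_gt_at_top[of 0]])
    fix n :: nat assume "0 < n"
    define k where "k = floor_sqrt n"
    have k: "0 < k" "k\<^sup>2 \<le> n" "n \<le> (Suc k)\<^sup>2"
      using \<open>0 < n\<close> Suc_floor_sqrt_power2_gt[of n] by (auto simp: k_def)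
    have "?a k * (real (k\<^sup>2) / real ((Suc k)\<^sup>2)) = s (k\<^sup>2) / real ((Suc k)\<^sup>2)"
      using k by simp
    also have "\<dots> \<le> s n / real n"
      using k \<open>0 < n\<close> mono nonneg by (intro frac_le) (auto simp: of_nat_le_iff simp del: of_nat_power)
    finally show "?a (floor_sqrt n) * (real ((floor_sqrt n)\<^sup>2) / real ((Suc (floor_sqrt n))\<^sup>2)) \<le> s n / real n"
      by (simp only: k_def)
    have "s n / real n \<le> s ((Suc k)\<^sup>2) / real (k\<^sup>2)"
      using k mono nonneg by (intro frac_le) (auto simp: of_nat_le_iff simp del: of_nat_power)
    also have "\<dots> = ?a (Suc k) * (real ((Suc k)\<^sup>2) / real (k\<^sup>2))"
      using k by simp
    finally show "s n / real n \<le>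
        ?a (Suc (floor_sqrt n)) * (real ((Suc (floor_sqrt n))\<^sup>2) / real ((floor_sqrt n)\<^sup>2))"
      by (simp only: k_def)
  qed
qed

text \<open>
  Along the squares, the mean square error of the average is at most $V / k^2$, which is summable;
  hence the sum of the squared errors has a finite expectation and its terms tend to 0 almost surely.
  Nonnegativity makes the partial sums monotone, which fills the gaps between the squares.
\<close>

theorem (in prob_space) strong_law_nonneg:
  fixes Y :: "nat \<Rightarrow> 'a \<Rightarrow> real"
  assumes indep: "indep_vars (\<lambda>_. borel) Y {1..}"
    and nonneg: "\<And>t \<omega>. 1 \<le> t \<Longrightarrow> 0 \<le> Y t \<omega>"
    and sq: "\<And>t. 1 \<le> t \<Longrightarrow> integrable M (\<lambda>\<omega>. (Y t \<omega>)\<^sup>2)"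
    and mean: "\<And>t. 1 \<le> t \<Longrightarrow> expectation (Y t) = \<mu>"
    and second: "\<And>t. 1 \<le> t \<Longrightarrow> expectation (\<lambda>\<omega>. (Y t \<omega>)\<^sup>2) \<le> V"
  shows "AE \<omega> in M. (\<lambda>n. (\<Sum>t=1..n. Y t \<omega>) / real n) \<longlonglongrightarrow> \<mu>"
proof -
  define Z where "Z t \<omega> = Y t \<omega> - \<mu>" for t \<omega>
  have rv: "Y t \<in> borel_measurable M" if "1 \<le> t" for t
    using indep that by (auto simp: indep_vars_def2)
  have int: "integrable M (Y t)" if "1 \<le> t" for t
    by (rule square_integrable_imp_integrable) (use rv sq that in auto)
  have Zsq: "(Z t \<omega>)\<^sup>2 = (Y t \<omega>)\<^sup>2 - 2 * \<mu> * Y t \<omega> + \<mu>\<^sup>2" for t \<omega>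
    by (simp add: Z_def power2_diff)
  have Zint: "integrable M (\<lambda>\<omega>. (Z t \<omega>)\<^sup>2)" if "1 \<le> t" for t
    unfolding Zsq using int sq that by auto
  have Zsecond: "expectation (\<lambda>\<omega>. (Z t \<omega>)\<^sup>2) \<le> V" if "1 \<le> t" for t
  proof -
    have "expectation (\<lambda>\<omega>. (Z t \<omega>)\<^sup>2) = expectation (\<lambda>\<omega>. (Y t \<omega>)\<^sup>2) - \<mu>\<^sup>2"
      unfolding Zsq using int sq mean that by (simp add: prob_space power2_eq_square)
    then show ?thesis using second[OF that] by (smt (verit) zero_le_power2)
  qed
  have Zmean: "expectation (Z t) = 0" if "1 \<le> t" for t
    unfolding Z_def using int[OF that] mean[OF that] by (simp add: prob_space)
  have Zindep: "indep_vars (\<lambda>_. borel) Z {1..}"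
    unfolding Z_def by (rule indep_vars_compose2[OF indep]) auto
  \<comment> \<open>\<open>D k\<close> is the squared error of the average of the first $k^2$ variables.\<close>
  define D where "D k \<omega> = ((\<Sum>t=1..k\<^sup>2. Z t \<omega>) / real (k\<^sup>2))\<^sup>2" for k \<omega>
  have Zrv[measurable]: "Z t \<in> borel_measurable M" if "1 \<le> t" for t
    unfolding Z_def using rv that by auto
  have Drv[measurable]: "D k \<in> borel_measurable M" for k
    unfolding D_def by (intro measurable) auto
  have D_le: "(\<integral>\<^sup>+\<omega>. ennreal (D k \<omega>) \<partial>M) \<le> ennreal (V * (1 / real k ^ 2))" for k
  proof (cases "k = 0")
    case False
    have *: "integrable M (\<lambda>\<omega>. (\<Sum>t=1..k\<^sup>2. Z t \<omega>)\<^sup>2)"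
      "expectation (\<lambda>\<omega>. (\<Sum>t=1..k\<^sup>2. Z t \<omega>)\<^sup>2) \<le> real (k\<^sup>2) * V"
      using second_moment_sum_indep_centered[of "{1..k\<^sup>2}" Z V]
        indep_vars_subset[OF Zindep, of "{1..k\<^sup>2}"] Zint Zmean Zsecond by auto
    have Dint: "integrable M (D k)"
      unfolding D_def power_divide using *(1) by auto
    have "(\<integral>\<^sup>+\<omega>. ennreal (D k \<omega>) \<partial>M) = ennreal (expectation (D k))"
      by (rule nn_integral_eq_integral[OF Dint]) (auto simp: D_def)
    also have "expectation (D k) = expectation (\<lambda>\<omega>. (\<Sum>t=1..k\<^sup>2. Z t \<omega>)\<^sup>2) / (real (k\<^sup>2))\<^sup>2"
      unfolding D_def power_divide by simp
    also have "\<dots> \<le> (real (k\<^sup>2) * V) / (real (k\<^sup>2))\<^sup>2"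
      by (intro divide_right_mono *(2)) auto
    also have "\<dots> = V * (1 / real k ^ 2)"
      using False by (simp add: power2_eq_square)
    finally show ?thesis by (simp add: ennreal_leI)
  qed (simp add: D_def)
  have V0: "0 \<le> V"
    using second[of 1] by (rule order_trans[rotated]) auto
  have sum_sq: "summable (\<lambda>k. V * (1 / real k ^ 2))"
    using inverse_power_summable[of 2, where 'a = real]
    by (intro summable_mult) (simp add: inverse_eq_divide power_one_over)
  have "(\<integral>\<^sup>+\<omega>. (\<Sum>k. ennreal (D k \<omega>)) \<partial>M) = (\<Sum>k. \<integral>\<^sup>+\<omega>. ennreal (D k \<omega>) \<partial>M)"
    by (rule nn_integral_suminf) auto
  also have "\<dots> \<le> (\<Sum>k. ennreal (V * (1 / real k ^ 2)))"
    by (intro suminf_le D_le) auto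
  also have "\<dots> = ennreal (\<Sum>k. V * (1 / real k ^ 2))"
    using V0 sum_sq by (intro suminf_ennreal2) auto
  finally have "(\<integral>\<^sup>+\<omega>. (\<Sum>k. ennreal (D k \<omega>)) \<partial>M) \<noteq> \<infinity>"
    by (auto simp: top_unique)
  then have "AE \<omega> in M. (\<Sum>k. ennreal (D k \<omega>)) \<noteq> \<infinity>"
    by (intro nn_integral_PInf_AE) auto
  then show ?thesis
  proof eventually_elim
    case (elim \<omega>)
    have "summable (\<lambda>k. D k \<omega>)"
      by (rule summable_suminf_not_top) (use elim in \<open>auto simp: D_def\<close>)
    then have "(\<lambda>k. D k \<omega>) \<longlonglongrightarrow> 0" by (rule summable_LIMSEQ_zero)
    then have "(\<lambda>k. sqrt (D k \<omega>)) \<longlonglongrightarrow> sqrt 0" by (rule tendsto_real_sqrt)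
    then have "(\<lambda>k. \<bar>(\<Sum>t=1..k\<^sup>2. Z t \<omega>) / real (k\<^sup>2)\<bar>) \<longlonglongrightarrow> 0"
      by (simp add: D_def)
    then have "(\<lambda>k. (\<Sum>t=1..k\<^sup>2. Z t \<omega>) / real (k\<^sup>2)) \<longlonglongrightarrow> 0"
      by (rule tendsto_rabs_zero_cancel)
    then have "(\<lambda>k. (\<Sum>t=1..k\<^sup>2. Z t \<omega>) / real (k\<^sup>2) + \<mu>) \<longlonglongrightarrow> 0 + \<mu>"
      by (intro tendsto_add) auto
    moreover have "\<forall>\<^sub>F k in sequentially. (\<Sum>t=1..k\<^sup>2. Z t \<omega>) / real (k\<^sup>2) + \<mu> =
        (\<Sum>t=1..k\<^sup>2. Y t \<omega>) / real (k\<^sup>2)"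
      using eventually_gt_at_top[of 0]
      by eventually_elim (simp add: Z_def sum_subtractf diff_divide_distrib)
    ultimately have "(\<lambda>k. (\<Sum>t=1..k\<^sup>2. Y t \<omega>) / real (k\<^sup>2)) \<longlonglongrightarrow> \<mu>"
      by (simp add: filterlim_cong)
    then show ?case
      by (intro averages_tendsto_from_squares sum_mono2 sum_nonneg) (auto intro: nonneg)
  qed
qed

section \<open>The normal loss function\<close>

lemma std_normal_density_minus: "std_normal_density (- x) = std_normal_density x"
  by (simp add: std_normal_density_def)

lemma std_normal_density_has_derivative:
  "(std_normal_density has_real_derivative - x * std_normal_density x) (at x)"
proof -
  have "((\<lambda>x. exp (- x\<^sup>2 / 2)) has_real_derivative exp (- x\<^sup>2 / 2) * - x) (at x)"
    by (auto intro!: derivative_eq_intros)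
  from DERIV_cmult[OF this, of "1 / sqrt (2 * pi)"] show ?thesis
    by (simp add: std_normal_density_def[abs_def] mult.commute)
qed

lemma continuous_on_std_normal_density: "continuous_on A std_normal_density"
  unfolding std_normal_density_def by (intro continuous_intros) auto

lemma std_normal_density_tendsto_0: "(std_normal_density \<longlongrightarrow> 0) at_top"
  unfolding std_normal_density_def by real_asymp

text \<open>
  The normal cdf is defined through a measure; as an integral of the continuous density over a
  compact interval it becomes accessible to the fundamental theorem of calculus.
\<close>

lemma std_normal_cdf_diff:
  assumes "a < x"
  shows "std_normal_cdf x - std_normal_cdf a = integral {a..x} std_normal_density"
proof -
  interpret real_distribution std_normal_distribution by (rule real_dist_normal_dist)
  have int: "set_integrable lborel {a<..x} std_normal_density"
    using integrable_std_normal_moment[of 0] unfolding set_integrable_def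
    by (intro integrable_mult_indicator) auto
  have "std_normal_cdf x - std_normal_cdf a = measure std_normal_distribution {a<..x}"
    unfolding std_normal_cdf_def using assms by (rule cdf_diff_eq)
  also have "\<dots> = (\<integral>y. indicator {a<..x} y \<partial>std_normal_distribution)"
    by simp
  also have "\<dots> = (LINT y:{a<..x}|lborel. std_normal_density y)"
    unfolding set_lebesgue_integral_def
    by (subst integral_density) (auto simp: mult.commute)
  also have "\<dots> = integral {a<..x} std_normal_density"
    by (rule set_borel_integral_eq_integral(2)[OF int])
  also have "\<dots> = integral {a..x} std_normal_density"
    by (rule integral_spike_set) (auto intro: negligible_subset[of "{a}"])
  finally show ?thesis .
qed

lemma std_normal_cdf_has_derivative:
  "(std_normal_cdf has_real_derivative std_normal_density x) (at x)"
proof -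
  have "((\<lambda>u. integral {x - 1..u} std_normal_density) has_real_derivative std_normal_density x)
      (at x within {x - 1..x + 1})"
    by (rule integral_has_real_derivative) (auto intro: continuous_on_std_normal_density)
  then have "((\<lambda>u. integral {x - 1..u} std_normal_density) has_real_derivative std_normal_density x) (at x)"
    by (simp add: at_within_Icc_at)
  then have "((\<lambda>u. std_normal_cdf (x - 1) + integral {x - 1..u} std_normal_density)
      has_real_derivative std_normal_density x) (at x)"
    by (auto intro!: derivative_eq_intros)
  then show ?thesis
  proof (rule has_field_derivative_transform_within_open[of _ _ _ "{x - 1<..}"])
    show "std_normal_cdf (x - 1) + integral {x - 1..u} std_normal_density = std_normal_cdf u"
      if "u \<in> {x - 1<..}" for u
      using std_normal_cdf_diff[of "x - 1" u] that by simp
  qed auto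
qed

lemma std_normal_cdf_tendsto_1: "(std_normal_cdf \<longlongrightarrow> 1) at_top"
  unfolding std_normal_cdf_def
  using real_distribution.axioms(1)[OF real_dist_normal_dist]
  by (intro real_distribution.cdf_lim_at_top_prob real_dist_normal_dist)

text \<open>
  The density is even, so $\Phi(z) + \Phi(-z)$ has derivative 0, and its limit at infinity is 1.
\<close>

lemma std_normal_cdf_minus: "std_normal_cdf (- z) = 1 - std_normal_cdf z"
proof -
  interpret real_distribution std_normal_distribution by (rule real_dist_normal_dist)
  let ?D = "\<lambda>x. std_normal_cdf x + std_normal_cdf (- x)"
  have "(?D has_real_derivative 0) (at x)" for x
    by (auto intro!: derivative_eq_intros std_normal_cdf_has_derivative
        DERIV_chain2[where f = std_normal_cdf and g = uminus and x = x]
        simp: std_normal_density_minus)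
  then have const: "?D x = ?D z" for x
    by (intro DERIV_isconst_all) auto
  have "(std_normal_cdf \<longlongrightarrow> 0) at_bot"
    unfolding std_normal_cdf_def by (rule cdf_lim_at_bot)
  then have "((\<lambda>x. std_normal_cdf (- x)) \<longlongrightarrow> 0) at_top"
    by (simp add: filterlim_at_bot_mirror)
  then have "(?D \<longlongrightarrow> 1 + 0) at_top"
    by (intro tendsto_add std_normal_cdf_tendsto_1)
  moreover have "(?D \<longlongrightarrow> ?D z) at_top"
    by (rule Lim_transform_eventually[OF tendsto_const]) (intro always_eventually allI const[symmetric])
  ultimately have "?D z = 1 + 0"
    using tendsto_unique[OF trivial_limit_at_top_linorder] by blast
  then show ?thesis by simp
qed

lemma Psi_has_derivative: "(Psi has_real_derivative std_normal_cdf z) (at z)"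
  unfolding Psi_def
  by (auto intro!: derivative_eq_intros std_normal_cdf_has_derivative std_normal_density_has_derivative)

lemma convex_Psi: "convex_on UNIV Psi"
proof (rule convex_on_realI)
  interpret real_distribution std_normal_distribution by (rule real_dist_normal_dist)
  show "std_normal_cdf x \<le> std_normal_cdf y" if "x \<le> y" for x y
    unfolding std_normal_cdf_def using that by (rule cdf_nondecreasing)
qed (auto intro: Psi_has_derivative)

text \<open>
  On $[-z, \infty)$, where the positive part is $s + z$, the integrand has the antiderivative
  $z \Phi(s) - \phi(s)$, which increases to $z$.
\<close>

lemma expectation_positive_part_std_normal:
  "(\<integral>s. std_normal_density s * max 0 (s + z) \<partial>lborel) = Psi z"
proof -
  let ?f = "\<lambda>s. (s + z) * std_normal_density s"
  let ?F = "\<lambda>s. z * std_normal_cdf s - std_normal_density s"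
  have lim: "(?F \<longlongrightarrow> z * 1 - 0) at_top"
    by (intro tendsto_intros std_normal_cdf_tendsto_1 std_normal_density_tendsto_0)
  have deriv: "(?F has_real_derivative ?f s) (at s)" for s
    by (auto intro!: derivative_eq_intros std_normal_cdf_has_derivative
        std_normal_density_has_derivative simp: algebra_simps)
  \<comment> \<open>Needed to return from extended nonnegative reals, where negative numbers become 0.\<close>
  have "?F (- z) \<le> ?F s" if "- z \<le> s" for s
    by (rule DERIV_nonneg_imp_nondecreasing[OF that]) (use deriv in fastforce)
  then have "?F (- z) \<le> z * 1 - 0"
    by (intro tendsto_lowerbound[OF lim] eventually_mono[OF eventually_ge_at_top[of "- z"]]) auto
  moreover have Psi_eq: "z - ?F (- z) = Psi z"
    by (simp add: Psi_def std_normal_cdf_minus std_normal_density_minus algebra_simps)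
  ultimately have "0 \<le> Psi z" by simp
  have "(\<integral>\<^sup>+s. ennreal (?f s) * indicator {- z..} s \<partial>lborel) = z - ?F (- z)"
    using nn_integral_FTC_atLeast[of ?f "- z" ?F "z * 1 - 0", OF _ deriv _ lim] by simp
  also note Psi_eq
  also have "(\<integral>\<^sup>+s. ennreal (?f s) * indicator {- z..} s \<partial>lborel) =
      (\<integral>\<^sup>+s. ennreal (std_normal_density s * max 0 (s + z)) \<partial>lborel)"
    by (intro nn_integral_cong) (auto simp: indicator_def max_def mult.commute)
  finally have *: "(\<integral>\<^sup>+s. ennreal (std_normal_density s * max 0 (s + z)) \<partial>lborel) = ennreal (Psi z)" .
  then show ?thesis
    using \<open>0 \<le> Psi z\<close> by (subst integral_eq_nn_integral) auto
qed

section \<open>Convex functions of one variable\<close>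

lemma segment_quotient_tendsto:
  fixes f :: "real \<Rightarrow> real"
  assumes "convex A" "x \<in> A" "y \<in> A" "(f has_real_derivative D) (at x within A)"
  shows "((\<lambda>u. (f (x + u * (y - x)) - f x) / u) \<longlongrightarrow> D * (y - x)) (at_right 0)"
proof -
  let ?p = "\<lambda>u. x + u * (y - x)"
  have "?p ` {0..1} \<subseteq> A"
  proof clarify
    fix u :: real assume "u \<in> {0..1}"
    then have "(1 - u) *\<^sub>R x + u *\<^sub>R y \<in> A"
      using assms by (intro convexD) auto
    then show "?p u \<in> A" by (simp add: algebra_simps)
  qed
  then have "(f has_real_derivative D) (at (?p 0) within ?p ` {0..1})"
    using assms(4) by (simp add: has_field_derivative_subset)
  moreover have "(?p has_real_derivative (y - x)) (at 0 within {0..1})"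
    by (auto intro!: derivative_eq_intros)
  ultimately have "((f \<circ> ?p) has_real_derivative D * (y - x)) (at 0 within {0..1})"
    by (rule DERIV_image_chain)
  then show ?thesis
    by (simp add: has_field_derivative_iff at_within_Icc_at_right)
qed

lemma convex_above_tangent:
  fixes f :: "real \<Rightarrow> real"
  assumes cvx: "convex_on A f" and D: "(f has_real_derivative D) (at x within A)"
    and "x \<in> A" "y \<in> A"
  shows "f x + D * (y - x) \<le> f y"
proof -
  have "convex A" using cvx by (rule convex_on_imp_convex)
  have "D * (y - x) \<le> f y - f x"
  proof (rule tendsto_upperbound[OF segment_quotient_tendsto[OF \<open>convex A\<close> \<open>x \<in> A\<close> \<open>y \<in> A\<close> D]])
    show "\<forall>\<^sub>F u in at_right 0. (f (x + u * (y - x)) - f x) / u \<le> f y - f x"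
    proof (rule eventually_mono[OF eventually_at_right_real[of 0 1]])
      fix u :: real assume u: "u \<in> {0<..<1}"
      then have "f ((1 - u) *\<^sub>R x + u *\<^sub>R y) \<le> (1 - u) * f x + u * f y"
        using convex_onD[OF cvx, of u x y] assms by simp
      moreover have "(1 - u) *\<^sub>R x + u *\<^sub>R y = x + u * (y - x)" by (simp add: algebra_simps)
      ultimately show "(f (x + u * (y - x)) - f x) / u \<le> f y - f x"
        using u by (simp add: divide_simps) (simp add: algebra_simps)
    qed simp
  qed simp
  then show ?thesis by simp
qed

lemma strictly_convex_on_imp_convex_on:
  assumes "strictly_convex_on A f" shows "convex_on A f"
proof (rule convex_onI)
  show "f ((1 - t) *\<^sub>R x + t *\<^sub>R y) \<le> (1 - t) * f x + t * f y"
    if "0 < t" "t < 1" "x \<in> A" "y \<in> A" for t x y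
    using assms that unfolding strictly_convex_on_def
    by (cases "x = y") (auto simp: algebra_simps intro: less_imp_le)
qed (use assms in \<open>simp add: strictly_convex_on_def\<close>)

text \<open>
  The tangent inequality at the midpoint and strict convexity between the midpoint and the end points.
\<close>

lemma strictly_convex_above_tangent:
  fixes f :: "real \<Rightarrow> real"
  assumes sc: "strictly_convex_on A f" and D: "(f has_real_derivative D) (at x within A)"
    and "x \<in> A" "y \<in> A" "x \<noteq> y"
  shows "f x + D * (y - x) < f y"
proof -
  let ?m = "(1 - 1/2) *\<^sub>R x + (1/2) *\<^sub>R y"
  have "?m \<in> A"
    using sc assms(3,4) unfolding strictly_convex_on_def by (intro convexD) auto
  then have "f x + D * (?m - x) \<le> f ?m"
    using convex_above_tangent[OF strictly_convex_on_imp_convex_on[OF sc] D] \<open>x \<in> A\<close> by blast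
  also have "f ?m < (1 - 1/2) * f x + 1/2 * f y"
  proof -
    have "\<forall>u. 0 < u \<longrightarrow> u < 1 \<longrightarrow> f ((1 - u) *\<^sub>R x + u *\<^sub>R y) < (1 - u) * f x + u * f y"
      using sc assms(3-5) unfolding strictly_convex_on_def by blast
    from this[THEN spec[of _ "1/2"]] show ?thesis by simp
  qed
  finally show ?thesis by (simp add: algebra_simps)
qed

text \<open>
  With $w = (1-t) y + t z$, the point $a / w$ is the convex combination of $a / y$ and $a / z$ with
  weights $(1-t) y / w$ and $t z / w$.
\<close>

lemma perspective_convex:
  fixes \<psi> :: "real \<Rightarrow> real"
  assumes "convex_on UNIV \<psi>"
  shows "convex_on {0<..} (\<lambda>y. y * \<psi> (a / y))"
proof (rule convex_onI)
  fix t y z :: real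
  assume t: "0 < t" "t < 1" and "y \<in> {0<..}" "z \<in> {0<..}"
  then have pos: "0 < y" "0 < z" by auto
  define w where "w = (1 - t) * y + t * z"
  have "0 < w" unfolding w_def using t pos by (simp add: add_pos_pos)
  define s where "s = t * z / w"
  have s: "1 - s = (1 - t) * y / w" "0 \<le> s" "s \<le> 1"
    using t pos \<open>0 < w\<close> by (auto simp: s_def w_def field_simps)
  have "a / w = (1 - s) *\<^sub>R (a / y) + s *\<^sub>R (a / z)"
    unfolding s(1) using pos \<open>0 < w\<close> by (simp add: s_def field_simps)
  then have "\<psi> (a / w) \<le> (1 - s) * \<psi> (a / y) + s * \<psi> (a / z)"
    using convex_onD[OF assms s(2,3), of "a / y" "a / z"] by simp
  then have "w * \<psi> (a / w) \<le> w * ((1 - s) * \<psi> (a / y) + s * \<psi> (a / z))"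
    using \<open>0 < w\<close> by (simp add: mult_left_mono)
  also have "\<dots> = (1 - t) * (y * \<psi> (a / y)) + t * (z * \<psi> (a / z))"
    unfolding s(1) using \<open>0 < w\<close> by (simp add: s_def field_simps)
  finally show "((1 - t) *\<^sub>R y + t *\<^sub>R z) * \<psi> (a / ((1 - t) *\<^sub>R y + t *\<^sub>R z))
      \<le> (1 - t) * (y * \<psi> (a / y)) + t * (z * \<psi> (a / z))"
    by (simp add: w_def)
qed simp

section \<open>Stationarity, continuous convergence and distances between sets\<close>

lemma local_minimizer_imp_limiting_stationary:
  fixes H :: "'a::real_inner \<Rightarrow> real"
  assumes "n \<in> N" "0 < \<epsilon>" and min: "\<And>m. m \<in> N \<Longrightarrow> norm (m - n) < \<epsilon> \<Longrightarrow> H n \<le> H m"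
  shows "0 \<in> limiting_subdiff (\<lambda>m. ereal (H m) + indicator_ext N m) n"
proof -
  let ?f = "\<lambda>m. ereal (H m) + indicator_ext N m"
  have fn: "?f n = ereal (H n)" using \<open>n \<in> N\<close> by (simp add: indicator_ext_def)
  have "\<forall>\<^sub>F y in at n. 0 \<le> (?f y - ?f n - ereal (0 \<bullet> (y - n))) / ereal (norm (n - y))"
    unfolding eventually_at
  proof (intro exI[of _ \<epsilon>] conjI ballI impI \<open>0 < \<epsilon>\<close>)
    fix y assume y: "y \<noteq> n \<and> dist y n < \<epsilon>"
    have pos: "0 < norm (n - y)" using y by auto
    show "0 \<le> (?f y - ?f n - ereal (0 \<bullet> (y - n))) / ereal (norm (n - y))"
    proof (cases "y \<in> N")
      case True
      then show ?thesis
        using min[of y] y pos \<open>n \<in> N\<close> by (simp add: fn indicator_ext_def dist_norm zero_ereal_def)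
    next
      case False
      then show ?thesis
        using pos by (simp add: fn indicator_ext_def)
    qed
  qed
  then have "0 \<le> Liminf (at n) (\<lambda>y. (?f y - ?f n - ereal (0 \<bullet> (y - n))) / ereal (norm (n - y)))"
    by (rule Liminf_bounded)
  then have "0 \<in> frechet_subdiff ?f n"
    by (simp add: frechet_subdiff_def fn)
  then show ?thesis
    unfolding limiting_subdiff_def
    by (intro CollectI exI[of _ "\<lambda>_. n"] exI[of _ "\<lambda>_. 0"]) auto
qed

text \<open>
  Continuous convergence: for continuous limits on the real line this is locally uniform convergence,
  in the form in which it composes with convergent arguments.
\<close>

definition continuously_convergent :: "(nat \<Rightarrow> real \<Rightarrow> real) \<Rightarrow> (real \<Rightarrow> real) \<Rightarrow> bool" where
  "continuously_convergent \<psi>s \<psi> \<longleftrightarrow>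
     (\<forall>zs z. zs \<longlonglongrightarrow> z \<longrightarrow> (\<lambda>k. \<psi>s k (zs k)) \<longlonglongrightarrow> \<psi> z)"

lemma continuously_convergent_const:
  assumes "convex_on UNIV \<psi>" shows "continuously_convergent (\<lambda>_. \<psi>) \<psi>"
proof -
  have "isCont \<psi> z" for z
    using convex_on_continuous[OF open_UNIV assms] by (simp add: continuous_on_eq_continuous_at)
  then show ?thesis
    unfolding continuously_convergent_def by (blast intro: isCont_tendsto_compose)
qed

text \<open>
  Arguments given along the subsequence are extended to all indices as a step function.
\<close>

lemma continuously_convergent_subseq:
  assumes "continuously_convergent \<psi>s \<psi>" "strict_mono k"
  shows "continuously_convergent (\<lambda>l. \<psi>s (k l)) \<psi>"
  unfolding continuously_convergent_def
proof (intro allI impI)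
  fix zs :: "nat \<Rightarrow> real" and z assume "zs \<longlonglongrightarrow> z"
  define zs' where "zs' M = zs (LEAST l. M \<le> k l)" for M
  have le: "M \<le> k M" for M using assms(2) by (rule seq_suble)
  have "filterlim (\<lambda>M. LEAST l. M \<le> k l) at_top sequentially"
    unfolding filterlim_at_top
  proof
    fix Z
    have "Z \<le> (LEAST l. M \<le> k l)" if "k Z \<le> M" for M
    proof -
      have "M \<le> k (LEAST l. M \<le> k l)" by (rule LeastI[of _ M]) (rule le)
      then have "k Z \<le> k (LEAST l. M \<le> k l)" using that by simp
      then show ?thesis using assms(2) by (simp add: strict_mono_less_eq)
    qed
    then show "\<forall>\<^sub>F M in sequentially. Z \<le> (LEAST l. M \<le> k l)"
      by (auto simp: eventually_sequentially)
  qed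
  then have "zs' \<longlonglongrightarrow> z"
    unfolding zs'_def using \<open>zs \<longlonglongrightarrow> z\<close> by (rule filterlim_compose[rotated])
  then have "(\<lambda>M. \<psi>s M (zs' M)) \<longlonglongrightarrow> \<psi> z"
    using assms(1) by (simp add: continuously_convergent_def)
  then have "((\<lambda>M. \<psi>s M (zs' M)) \<circ> k) \<longlonglongrightarrow> \<psi> z"
    using assms(2) by (rule LIMSEQ_subseq_LIMSEQ)
  moreover have "zs' (k l) = zs l" for l
    proof -
    have "(LEAST l'. k l \<le> k l') = l"
      using assms(2) by (intro Least_equality) (auto simp: strict_mono_less_eq)
    then show ?thesis by (simp add: zs'_def)
  qed
  ultimately show "(\<lambda>l. \<psi>s (k l) (zs l)) \<longlonglongrightarrow> \<psi> z"
    by (simp add: comp_def)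
qed

lemma not_eventually_imp_subseq:
  assumes "\<not> eventually P sequentially"
  obtains k :: "nat \<Rightarrow> nat" where "strict_mono k" "\<And>l. \<not> P (k l)"
proof -
  have "infinite {n. \<not> P n}"
    using assms by (simp add: frequently_cofinite[symmetric] cofinite_eq_sequentially not_eventually)
  from infinite_enumerate[OF this] show thesis using that by auto
qed

lemma box_set_eq_cbox: "box_set b = cbox 0 (\<chi> j. b)"
  by (auto simp: box_set_def mem_box_cart)

lemma closed_box_set: "closed (box_set b)"
  unfolding box_set_eq_cbox by (rule closed_cbox)

lemma compact_box_set: "compact (box_set b)"
  unfolding box_set_eq_cbox by (rule compact_cbox)

lemma finite_binary_budget_set: "finite (binary_budget_set p :: (real ^ 'i::finite) set)"
proof (rule finite_subset)
  show "binary_budget_set p \<subseteq> (vec_lambda ` (PiE UNIV (\<lambda>_. {0, 1})) :: (real ^ 'i) set)"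
  proof
    fix x :: "real ^ 'i" assume "x \<in> binary_budget_set p"
    then have "vec_nth x \<in> PiE UNIV (\<lambda>_. {0, 1})" by (auto simp: binary_budget_set_def)
    then show "x \<in> vec_lambda ` (PiE UNIV (\<lambda>_. {0, 1}))"
      by (intro image_eqI[of _ _ "vec_nth x"]) auto
  qed
qed (intro finite_imageI finite_PiE; simp)

lemma is_arg_min_iff_le:
  fixes f :: "'a \<Rightarrow> real"
  shows "is_arg_min f P x \<longleftrightarrow> P x \<and> (\<forall>y. P y \<longrightarrow> f x \<le> f y)"
  by (auto simp: is_arg_min_def not_less)

lemma dist_to_set_le: "l \<in> B \<Longrightarrow> dist_to_set a B \<le> ennreal (dist a l)"
  unfolding dist_to_set_def by (rule INF_lower)

text \<open>
  If the excess stayed above some $\varepsilon$ along a subsequence, points of the sets nearly attaining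
  it would cluster at a point of $B$.
\<close>

lemma excess_dist_tendsto_0I:
  assumes cluster: "\<And>k y. strict_mono (k :: nat \<Rightarrow> nat) \<Longrightarrow> (\<And>l. y l \<in> A (k l)) \<Longrightarrow>
    \<exists>k' l. strict_mono (k' :: nat \<Rightarrow> nat) \<and> l \<in> B \<and> (y \<circ> k') \<longlonglongrightarrow> l"
  shows "(\<lambda>M. excess_dist (A M) B) \<longlonglongrightarrow> 0"
proof (rule tendsto_zero_ennreal, rule ccontr)
  fix \<epsilon> :: real assume "0 < \<epsilon>"
  assume "\<not> (\<forall>\<^sub>F M in sequentially. excess_dist (A M) B < ennreal \<epsilon>)"
  then obtain k :: "nat \<Rightarrow> nat" where k: "strict_mono k" "\<And>l. \<not> excess_dist (A (k l)) B < ennreal \<epsilon>"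
    by (rule not_eventually_imp_subseq) blast
  have "\<exists>y\<in>A (k l). ennreal (\<epsilon> / 2) < dist_to_set y B" for l
  proof -
    have "ennreal (\<epsilon> / 2) < ennreal \<epsilon>" using \<open>0 < \<epsilon>\<close> by (intro ennreal_lessI) auto
    also have "\<dots> \<le> excess_dist (A (k l)) B" using k(2)[of l] by simp
    finally show ?thesis unfolding excess_dist_def less_SUP_iff .
  qed
  then obtain y where y: "\<And>l. y l \<in> A (k l)" "\<And>l. ennreal (\<epsilon> / 2) < dist_to_set (y l) B"
    by metis
  obtain k' l where "l \<in> B" and lim: "(y \<circ> k') \<longlonglongrightarrow> l"
    using cluster[OF k(1) y(1)] by blast
  have "\<forall>\<^sub>F i in sequentially. dist ((y \<circ> k') i) l < \<epsilon> / 2"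
    using tendstoD[OF lim, of "\<epsilon> / 2"] \<open>0 < \<epsilon>\<close> by simp
  then obtain i where i: "dist (y (k' i)) l < \<epsilon> / 2"
    by (auto simp: eventually_sequentially)
  have "dist_to_set (y (k' i)) B \<le> ennreal (dist (y (k' i)) l)"
    using \<open>l \<in> B\<close> by (rule dist_to_set_le)
  also have "\<dots> \<le> ennreal (\<epsilon> / 2)" using i by (intro ennreal_leI) simp
  finally show False using y(2)[of "k' i"] by simp
qed

lemma excess_dist_finite_tendsto_0I:
  assumes "finite B" and approx: "\<And>l. l \<in> B \<Longrightarrow> \<exists>y. y \<longlonglongrightarrow> l \<and> (\<forall>\<^sub>F M in sequentially. y M \<in> A M)"
  shows "(\<lambda>M. excess_dist B (A M)) \<longlonglongrightarrow> 0"
proof (rule tendsto_zero_ennreal)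
  fix \<epsilon> :: real assume "0 < \<epsilon>"
  have "\<forall>\<^sub>F M in sequentially. dist_to_set l (A M) \<le> ennreal (\<epsilon> / 2)" if "l \<in> B" for l
  proof -
    from approx[OF that] obtain y where y: "y \<longlonglongrightarrow> l" "\<forall>\<^sub>F M in sequentially. y M \<in> A M"
      by blast
    have "\<forall>\<^sub>F M in sequentially. dist (y M) l < \<epsilon> / 2"
      using tendstoD[OF y(1), of "\<epsilon> / 2"] \<open>0 < \<epsilon>\<close> by simp
    with y(2) show ?thesis
    proof eventually_elim
      case (elim M)
      then have "dist_to_set l (A M) \<le> ennreal (dist l (y M))" by (intro dist_to_set_le)
      also have "\<dots> \<le> ennreal (\<epsilon> / 2)" using elim by (intro ennreal_leI) (simp add: dist_commute)
      finally show ?case .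
    qed
  qed
  then have "\<forall>\<^sub>F M in sequentially. \<forall>l\<in>B. dist_to_set l (A M) \<le> ennreal (\<epsilon> / 2)"
    using \<open>finite B\<close> by (simp add: eventually_ball_finite)
  then show "\<forall>\<^sub>F M in sequentially. excess_dist B (A M) < ennreal \<epsilon>"
  proof eventually_elim
    case (elim M)
    then have "excess_dist B (A M) \<le> ennreal (\<epsilon> / 2)"
      unfolding excess_dist_def by (intro SUP_least) auto
    also have "\<dots> < ennreal \<epsilon>" using \<open>0 < \<epsilon>\<close> by (intro ennreal_lessI) auto
    finally show ?case .
  qed
qed

section \<open>Critical points of separable objectives\<close>

text \<open>
  The parameters $\sigma_j$ are fixed: \<open>\<eta> j\<close> stands for $h_j(\cdot; \sigma_j)$ and \<open>\<eta>' j\<close> for its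
  derivative, one-sided at 0. The loss function $\psi$ stays a parameter of the objective, since
  $F$ and $F_M$ differ only in it.
\<close>

locale sampling_design =
  fixes X :: "(real ^ 'i::finite) set" and b e :: real
    and d :: "real ^ 'j::finite" and r :: "real ^ 'i"
    and q :: "'i \<Rightarrow> 'j \<Rightarrow> real" and g :: "'i \<Rightarrow> 'j \<Rightarrow> real ^ 'i \<Rightarrow> real"
    and \<eta> \<eta>' :: "'j \<Rightarrow> real \<Rightarrow> real"
  assumes finite_X: "finite X"
    and q_pos: "\<And>i j. 0 < q i j"
    and g_continuous: "\<And>i j. continuous_on UNIV (g i j)"
    and \<eta>_pos: "\<And>j m. 0 \<le> m \<Longrightarrow> 0 < \<eta> j m"
    and \<eta>_convex: "\<And>j. strictly_convex_on {0..} (\<eta> j)"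
    and \<eta>_antimono: "\<And>j. antimono_on {0..} (\<eta> j)"
    and \<eta>'_continuous: "\<And>j. continuous_on {0..} (\<eta>' j)"
    and \<eta>_deriv: "\<And>j m. 0 \<le> m \<Longrightarrow> (\<eta> j has_real_derivative \<eta>' j m) (at m within {0..})"
begin

text \<open>
  The cost of noise level $y = \eta_j(n_j)$: a weighted sum of perspectives of the loss function.
\<close>

definition cost :: "(real \<Rightarrow> real) \<Rightarrow> real ^ 'i \<Rightarrow> 'j \<Rightarrow> real \<Rightarrow> real" where
  "cost \<psi> x j y = y * (\<Sum>i\<in>UNIV. q i j * \<psi> (g i j x / y))"

definition objective :: "(real \<Rightarrow> real) \<Rightarrow> real ^ 'i \<Rightarrow> real ^ 'j \<Rightarrow> real" where
  "objective \<psi> x n = e + d \<bullet> n + r \<bullet> x + (\<Sum>j\<in>UNIV. cost \<psi> x j (\<eta> j (n $ j)))"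

text \<open>
  The first-order condition on $[0,b]$ for the objective minus the linear function $v$, coordinate by
  coordinate and read in the coordinate $y = \eta_j(m)$. Only the term $(d_j - v_j) m$ is linearized in
  $y$, with slope $(d_j - v_j) / \eta_j'(n_j)$; the convex term enters through its values. This keeps
  subgradients out of the condition, so that it passes to limits in $\psi$, $v$, $x$ and $n$.
\<close>

definition critical :: "(real \<Rightarrow> real) \<Rightarrow> real ^ 'j \<Rightarrow> real ^ 'i \<Rightarrow> real ^ 'j \<Rightarrow> bool" where
  "critical \<psi> v x n \<longleftrightarrow> n \<in> box_set b \<and>
     (\<forall>j. \<forall>m\<in>{0..b}. 0 \<le> (d $ j - v $ j) / \<eta>' j (n $ j) * (\<eta> j m - \<eta> j (n $ j))
        + (cost \<psi> x j (\<eta> j m) - cost \<psi> x j (\<eta> j (n $ j))))"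

abbreviation stationary :: "(real \<Rightarrow> real) \<Rightarrow> ((real ^ 'i) \<times> (real ^ 'j)) set" where
  "stationary \<psi> \<equiv> stationary_set X (box_set b) (objective \<psi>)"

lemma \<eta>_above_tangent:
  assumes "0 \<le> m" "0 \<le> m'" "m \<noteq> m'"
  shows "\<eta> j m + \<eta>' j m * (m' - m) < \<eta> j m'"
  using strictly_convex_above_tangent[OF \<eta>_convex \<eta>_deriv] assms by auto

text \<open>
  A zero of the derivative would make a decreasing convex function constant from there on, which
  strict convexity excludes.
\<close>

lemma \<eta>'_neg:
  assumes "0 \<le> m" shows "\<eta>' j m < 0"
proof -
  have "\<eta> j m + \<eta>' j m * (m + 1 - m) < \<eta> j (m + 1)"
    using assms by (intro \<eta>_above_tangent) auto
  also have "\<dots> \<le> \<eta> j m"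
    using \<eta>_antimono[of j] assms by (auto simp: monotone_on_def)
  finally show ?thesis by simp
qed

lemma \<eta>_strict_antimono:
  assumes "0 \<le> m" "m < m'" shows "\<eta> j m' < \<eta> j m"
proof -
  have "\<eta>' j m' * (m - m') > 0"
    using \<eta>'_neg[of m' j] assms by (intro mult_neg_neg) auto
  then show ?thesis using \<eta>_above_tangent[of m' m j] assms by auto
qed

lemma box_coord: "n \<in> box_set b \<Longrightarrow> 0 \<le> n $ j" "n \<in> box_set b \<Longrightarrow> n $ j \<le> b"
  by (auto simp: box_set_def)

lemma \<eta>_tendsto:
  assumes "(ms \<longlongrightarrow> m) F" "\<forall>\<^sub>F k in F. 0 \<le> ms k" "0 \<le> m"
  shows "((\<lambda>k. \<eta> j (ms k)) \<longlongrightarrow> \<eta> j m) F" "((\<lambda>k. \<eta>' j (ms k)) \<longlongrightarrow> \<eta>' j m) F"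
proof -
  have "continuous_on {0..} (\<eta> j)"
    using \<eta>_deriv by (intro DERIV_continuous_on) auto
  then show "((\<lambda>k. \<eta> j (ms k)) \<longlongrightarrow> \<eta> j m) F"
    using assms by (intro continuous_on_tendsto_compose[where f = "\<eta> j"]) auto
  show "((\<lambda>k. \<eta>' j (ms k)) \<longlongrightarrow> \<eta>' j m) F"
    using assms \<eta>'_continuous by (intro continuous_on_tendsto_compose[where f = "\<eta>' j"]) auto
qed

lemma cost_eq: "cost \<psi> x j = (\<lambda>y. \<Sum>i\<in>UNIV. q i j * (y * \<psi> (g i j x / y)))"
  by (auto simp: cost_def sum_distrib_left mult.left_commute)

lemma cost_convex:
  assumes "convex_on UNIV \<psi>" shows "convex_on {0<..} (cost \<psi> x j)"
proof -
  have "convex_on {0<..} (\<lambda>y. \<Sum>i\<in>I. q i j * (y * \<psi> (g i j x / y)))" for I :: "'i set"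
    by (induction I rule: infinite_finite_induct)
      (auto intro!: convex_on_add convex_on_cmul perspective_convex assms less_imp_le[OF q_pos]
        simp: convex_on_const)
  then show ?thesis unfolding cost_eq .
qed

lemma cost_tendsto:
  assumes "continuously_convergent \<psi>s \<psi>" "xs \<longlonglongrightarrow> x" "ys \<longlonglongrightarrow> y" "0 < y"
  shows "(\<lambda>k. cost (\<psi>s k) (xs k) j (ys k)) \<longlonglongrightarrow> cost \<psi> x j y"
proof -
  have "(\<lambda>k. g i j (xs k)) \<longlonglongrightarrow> g i j x" for i
    using g_continuous assms(2) by (rule continuous_on_tendsto_compose) auto
  then have "(\<lambda>k. g i j (xs k) / ys k) \<longlonglongrightarrow> g i j x / y" for i
    using assms(3,4) by (intro tendsto_divide) auto
  then have "(\<lambda>k. \<psi>s k (g i j (xs k) / ys k)) \<longlonglongrightarrow> \<psi> (g i j x / y)" for i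
    using assms(1) unfolding continuously_convergent_def by blast
  then show ?thesis
    unfolding cost_def by (intro tendsto_intros assms(3))
qed

lemma objective_tendsto:
  assumes "continuously_convergent \<psi>s \<psi>" "xs \<longlonglongrightarrow> x" "ns \<longlonglongrightarrow> n" "\<And>k. ns k \<in> box_set b"
  shows "(\<lambda>k. objective (\<psi>s k) (xs k) (ns k)) \<longlonglongrightarrow> objective \<psi> x n"
proof -
  have "n \<in> box_set b"
    by (rule closed_sequentially[OF closed_box_set]) (use assms in auto)
  then have "(\<lambda>k. \<eta> j (ns k $ j)) \<longlonglongrightarrow> \<eta> j (n $ j)" "0 < \<eta> j (n $ j)" for j
    using assms(3,4) by (auto intro!: \<eta>_tendsto \<eta>_pos tendsto_vec_nth simp: box_coord)
  then show ?thesis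
    unfolding objective_def by (intro tendsto_intros cost_tendsto assms)
qed

lemma objective_continuous_on_box:
  assumes "convex_on UNIV \<psi>" shows "continuous_on (box_set b) (objective \<psi> x)"
  unfolding continuous_on_sequentially comp_def
  using objective_tendsto[OF continuously_convergent_const[OF assms] tendsto_const] by blast

lemma critical_limit:
  assumes "continuously_convergent \<psi>s \<psi>" "xs \<longlonglongrightarrow> x" "ns \<longlonglongrightarrow> n" "vs \<longlonglongrightarrow> v"
    and crit: "\<And>k. critical (\<psi>s k) (vs k) (xs k) (ns k)"
  shows "critical \<psi> v x n"
  unfolding critical_def
proof (intro conjI allI ballI)
  have box: "ns k \<in> box_set b" for k using crit by (simp add: critical_def)
  show n: "n \<in> box_set b"
    by (rule closed_sequentially[OF closed_box_set _ assms(3)]) (use box in auto)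
  fix j m assume m: "m \<in> {0..b}"
  have \<eta>n: "(\<lambda>k. \<eta> j (ns k $ j)) \<longlonglongrightarrow> \<eta> j (n $ j)" "(\<lambda>k. \<eta>' j (ns k $ j)) \<longlonglongrightarrow> \<eta>' j (n $ j)"
    using assms(3) n box by (auto intro!: \<eta>_tendsto tendsto_vec_nth simp: box_coord)
  have nz: "\<eta>' j (n $ j) \<noteq> 0" using \<eta>'_neg[of "n $ j" j] n by (auto simp: box_coord)
  have pos: "0 < \<eta> j m" "0 < \<eta> j (n $ j)" using m n by (auto intro!: \<eta>_pos simp: box_coord)
  have "(\<lambda>k. (d $ j - vs k $ j) / \<eta>' j (ns k $ j) * (\<eta> j m - \<eta> j (ns k $ j))
        + (cost (\<psi>s k) (xs k) j (\<eta> j m) - cost (\<psi>s k) (xs k) j (\<eta> j (ns k $ j))))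
     \<longlonglongrightarrow> (d $ j - v $ j) / \<eta>' j (n $ j) * (\<eta> j m - \<eta> j (n $ j))
        + (cost \<psi> x j (\<eta> j m) - cost \<psi> x j (\<eta> j (n $ j)))"
    by (intro tendsto_intros cost_tendsto[OF assms(1,2)] assms(4) \<eta>n nz pos)
  then show "0 \<le> (d $ j - v $ j) / \<eta>' j (n $ j) * (\<eta> j m - \<eta> j (n $ j))
        + (cost \<psi> x j (\<eta> j m) - cost \<psi> x j (\<eta> j (n $ j)))"
    by (rule LIMSEQ_le_const) (use crit m in \<open>auto simp: critical_def\<close>)
qed

lemma objective_diff:
  "objective \<psi> x m - objective \<psi> x n =
     (\<Sum>j\<in>UNIV. d $ j * (m $ j - n $ j) + (cost \<psi> x j (\<eta> j (m $ j)) - cost \<psi> x j (\<eta> j (n $ j))))"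
  by (simp add: objective_def inner_vec_def sum.distrib sum_subtractf algebra_simps)

text \<open>
  Move coordinate $j$ of $n$ a fraction $u$ of the way towards $m$. The noise level then covers a
  fraction $\theta(u)$ of the way from $\eta_j(n_j)$ to $\eta_j(m)$, and by convexity the cost changes by
  at most $\theta(u)$ times its total change. A Frechet subgradient bounds the change of the objective
  from below to first order in $u$; dividing by $u$ and letting $u \to 0$ turns $\theta(u) / u$ into
  $\eta_j'(n_j) (m - n_j) / (\eta_j(m) - \eta_j(n_j)) > 0$, and division by this number gives the claim.
\<close>

lemma frechet_imp_critical:
  assumes \<psi>: "convex_on UNIV \<psi>"
    and v: "v \<in> frechet_subdiff (\<lambda>m. ereal (objective \<psi> x m) + indicator_ext (box_set b) m) n"
  shows "critical \<psi> v x n"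
  unfolding critical_def
proof (intro conjI allI ballI)
  let ?f = "\<lambda>m. ereal (objective \<psi> x m) + indicator_ext (box_set b) m"
  show n: "n \<in> box_set b"
    using v by (auto simp: frechet_subdiff_def indicator_ext_def split: if_splits)
  fix j m assume m: "m \<in> {0..b}"
  let ?c = "\<lambda>t. cost \<psi> x j (\<eta> j t)"
  show "0 \<le> (d $ j - v $ j) / \<eta>' j (n $ j) * (\<eta> j m - \<eta> j (n $ j)) + (?c m - ?c (n $ j))"
  proof (cases "m = n $ j")
    case False
    define a where "a = n $ j"
    have a: "0 \<le> a" "a \<le> b" using n by (auto simp: a_def box_coord)
    have "m \<noteq> a" using False by (simp add: a_def)
    then have sgn: "(m < a \<and> \<eta> j a < \<eta> j m) \<or> (a < m \<and> \<eta> j m < \<eta> j a)"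
      using a m \<eta>_strict_antimono[of m a j] \<eta>_strict_antimono[of a m j] by (auto simp: neq_iff)
    define t where "t u = a + u * (m - a)" for u
    define y where "y u = n + axis j (u * (m - a))" for u
    have y_nth: "y u $ k = (if k = j then t u else n $ k)" for u k
      by (simp add: y_def t_def a_def axis_def)
    define \<theta> where "\<theta> u = (\<eta> j (t u) - \<eta> j a) / (\<eta> j m - \<eta> j a)" for u
    \<comment> \<open>\<open>u * Q u\<close> bounds the change of the tilted objective along the segment from above.\<close>
    define Q where "Q u = (d $ j - v $ j) * (m - a) + \<theta> u / u * (?c m - ?c a)" for u
    define L where "L = (d $ j - v $ j) * (m - a) + \<eta>' j a * (m - a) / (\<eta> j m - \<eta> j a) * (?c m - ?c a)"
    have "((\<lambda>u. (\<eta> j (t u) - \<eta> j a) / u) \<longlongrightarrow> \<eta>' j a * (m - a)) (at_right 0)"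
      unfolding t_def using a m by (intro segment_quotient_tendsto[of "{0..}"] \<eta>_deriv) auto
    then have "((\<lambda>u. (d $ j - v $ j) * (m - a) +
        (\<eta> j (t u) - \<eta> j a) / u / (\<eta> j m - \<eta> j a) * (?c m - ?c a)) \<longlongrightarrow> L) (at_right 0)"
      unfolding L_def using sgn by (intro tendsto_intros) auto
    then have Q_lim: "(Q \<longlongrightarrow> L) (at_right 0)"
      unfolding Q_def \<theta>_def by (simp add: mult.commute)
    have y_at: "filterlim y (at n) (at_right 0)"
      unfolding filterlim_at
    proof
      have "((\<lambda>u. n + axis j (u * (m - a))) \<longlongrightarrow> n) (at_right 0)"
      proof (rule vec_tendstoI)
        fix k
        have "((\<lambda>u. n $ k + u * (if k = j then m - a else 0)) \<longlongrightarrow> n $ k) (at_right 0)"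
          by (auto intro!: tendsto_eq_intros)
        then show "((\<lambda>u. (n + axis j (u * (m - a))) $ k) \<longlongrightarrow> n $ k) (at_right 0)"
          by (simp add: axis_def if_distrib cong: if_cong)
      qed
      then show "(y \<longlongrightarrow> n) (at_right 0)" unfolding y_def .
      show "\<forall>\<^sub>F u in at_right 0. y u \<in> UNIV \<and> y u \<noteq> n"
        using \<open>m \<noteq> a\<close> by (intro eventually_at_rightI[of 0 1]) (auto simp: y_def axis_eq_0_iff)
    qed
    have L_ge: "- \<epsilon> * \<bar>m - a\<bar> \<le> L" if "0 < \<epsilon>" for \<epsilon>
    proof (rule tendsto_lowerbound[OF Q_lim])
      have "\<forall>\<^sub>F z in at n. ereal (- \<epsilon>) < (?f z - ?f n - ereal (v \<bullet> (z - n))) / ereal (norm (n - z))"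
        using v that unfolding frechet_subdiff_def le_Liminf_iff by simp
      from eventually_compose_filterlim[OF this y_at] eventually_at_right_real[of 0 1]
      have "\<forall>\<^sub>F u in at_right 0. ereal (- \<epsilon>) <
          (?f (y u) - ?f n - ereal (v \<bullet> (y u - n))) / ereal (norm (n - y u)) \<and> u \<in> {0<..<1}"
        by (simp add: eventually_conj_iff)
      then show "\<forall>\<^sub>F u in at_right 0. - \<epsilon> * \<bar>m - a\<bar> \<le> Q u"
      proof (rule eventually_mono)
        fix u assume u: "ereal (- \<epsilon>) <
          (?f (y u) - ?f n - ereal (v \<bullet> (y u - n))) / ereal (norm (n - y u)) \<and> u \<in> {0<..<1}"
        then have u01: "0 < u" "u < 1" by auto
        have t_conv: "t u = (1 - u) *\<^sub>R a + u *\<^sub>R m" by (simp add: t_def algebra_simps)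
        have t_in: "t u \<in> {0..b}"
          unfolding t_conv using u01 a m by (intro convexD) auto
        have y_box: "y u \<in> box_set b"
          using n t_in by (auto simp: box_set_def y_nth)
        have ny: "norm (n - y u) = u * \<bar>m - a\<bar>"
          using u01 by (simp add: y_def norm_eq_sqrt_inner inner_axis_axis abs_mult)
        have vy: "v \<bullet> (y u - n) = u * ((m - a) * v $ j)"
          by (simp add: y_def inner_axis)
        have obj: "objective \<psi> x (y u) - objective \<psi> x n = d $ j * (u * (m - a)) + (?c (t u) - ?c a)"
        proof -
          have "objective \<psi> x (y u) - objective \<psi> x n =
              (\<Sum>k\<in>UNIV. if k = j then d $ j * (t u - a) + (?c (t u) - ?c a) else 0)"
            unfolding objective_diff by (intro sum.cong) (auto simp: y_nth a_def)
          then show ?thesis by (simp add: t_def)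
        qed
        have \<theta>01: "0 \<le> \<theta> u" "\<theta> u \<le> 1"
        proof -
          have "(m < t u \<and> t u < a) \<or> (a < t u \<and> t u < m)"
            using sgn u01 unfolding t_def by (smt (verit) mult_less_cancel_right2 mult_pos_neg mult_pos_pos mult_minus_right)
          then have "(\<eta> j a < \<eta> j (t u) \<and> \<eta> j (t u) < \<eta> j m) \<or> (\<eta> j m < \<eta> j (t u) \<and> \<eta> j (t u) < \<eta> j a)"
            using \<eta>_strict_antimono a m by auto
          then show "0 \<le> \<theta> u" "\<theta> u \<le> 1" by (auto simp: \<theta>_def divide_simps)
        qed
        have "\<eta> j (t u) = (1 - \<theta> u) *\<^sub>R \<eta> j a + \<theta> u *\<^sub>R \<eta> j m"
          using sgn by (auto simp: \<theta>_def field_simps)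
        then have "?c (t u) \<le> (1 - \<theta> u) * ?c a + \<theta> u * ?c m"
          using convex_onD[OF cost_convex[OF \<psi>] \<theta>01, of "\<eta> j a" "\<eta> j m" x j] a m \<eta>_pos by simp
        then have c_le: "?c (t u) - ?c a \<le> \<theta> u * (?c m - ?c a)" by (simp add: algebra_simps)
        have "- \<epsilon> < (objective \<psi> x (y u) - objective \<psi> x n - v \<bullet> (y u - n)) / norm (n - y u)"
          using u n y_box u01 \<open>m \<noteq> a\<close> by (simp add: indicator_ext_def ny split: if_splits)
        then have "- \<epsilon> * (u * \<bar>m - a\<bar>) < objective \<psi> x (y u) - objective \<psi> x n - v \<bullet> (y u - n)"
          unfolding ny using u01 \<open>m \<noteq> a\<close> by (simp add: pos_less_divide_eq)
        also have "\<dots> \<le> u * ((d $ j - v $ j) * (m - a)) + \<theta> u * (?c m - ?c a)"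
          unfolding obj vy using c_le by (simp add: algebra_simps)
        also have "\<dots> = u * Q u"
          using u01 by (simp add: Q_def distrib_left)
        finally have "u * (- \<epsilon> * \<bar>m - a\<bar>) < u * Q u" by (simp add: algebra_simps)
        then have "- \<epsilon> * \<bar>m - a\<bar> < Q u" using u01(1) by (simp only: mult_less_cancel_left_pos)
        then show "- \<epsilon> * \<bar>m - a\<bar> \<le> Q u" by simp
      qed
    qed simp
    have "0 \<le> L"
    proof (rule field_le_epsilon)
      fix \<epsilon> :: real assume "0 < \<epsilon>"
      then show "0 \<le> L + \<epsilon>"
        using L_ge[of "\<epsilon> / \<bar>m - a\<bar>"] \<open>m \<noteq> a\<close> by simp
    qed
    moreover have "0 < (\<eta> j m - \<eta> j a) / (\<eta>' j a * (m - a))"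
      using sgn \<eta>'_neg[of a j] a by (auto simp: zero_less_divide_iff zero_less_mult_iff mult_less_0_iff)
    ultimately have "0 \<le> (\<eta> j m - \<eta> j a) / (\<eta>' j a * (m - a)) * L"
      by (metis less_imp_le mult_nonneg_nonneg)
    also have "\<dots> = (d $ j - v $ j) / \<eta>' j a * (\<eta> j m - \<eta> j a) + (?c m - ?c a)"
    proof -
      have "A / (w * s) * (D * s + w * s / A * C) = D / w * A + C"
        if "A \<noteq> 0" "w \<noteq> 0" "s \<noteq> 0" for A w s D C :: real
        using that by (simp add: field_simps)
      moreover have "\<eta> j m - \<eta> j a \<noteq> 0" "\<eta>' j a \<noteq> 0" "m - a \<noteq> 0"
        using sgn \<eta>'_neg[of a j] a by auto
      ultimately show ?thesis unfolding L_def .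
    qed
    finally show ?thesis by (simp add: a_def)
  qed simp
qed

lemma stationary_imp_critical:
  assumes \<psi>: "convex_on UNIV \<psi>"
    and 0: "0 \<in> limiting_subdiff (\<lambda>m. ereal (objective \<psi> x m) + indicator_ext (box_set b) m) n"
  shows "critical \<psi> 0 x n"
proof -
  from 0 obtain ns vs where "ns \<longlonglongrightarrow> n" "vs \<longlonglongrightarrow> 0"
    and "\<And>k. vs k \<in> frechet_subdiff (\<lambda>m. ereal (objective \<psi> x m) + indicator_ext (box_set b) m) (ns k)"
    unfolding limiting_subdiff_def by blast
  then show ?thesis
    using critical_limit[OF continuously_convergent_const[OF \<psi>] tendsto_const, of ns n vs 0 x]
      frechet_imp_critical[OF \<psi>] by blast
qed

section \<open>Minimizers and stationary points\<close>

text \<open>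
  For $\psi = \Psi$ the bracket is the normal density at $g_{ij}(x) / y$.
\<close>

lemma cost_has_derivative:
  assumes "\<And>z. (\<psi> has_real_derivative \<psi>' z) (at z)" "0 < y"
  shows "(cost \<psi> x j has_real_derivative
    (\<Sum>i\<in>UNIV. q i j * (\<psi> (g i j x / y) - g i j x / y * \<psi>' (g i j x / y)))) (at y)"
proof -
  have "((\<lambda>y. y * \<psi> (a / y)) has_real_derivative (\<psi> (a / y) - a / y * \<psi>' (a / y))) (at y)" for a
    using \<open>0 < y\<close>
    by (auto intro!: derivative_eq_intros DERIV_chain2[OF assms(1)] simp: field_simps)
  then show ?thesis
    unfolding cost_eq by (intro DERIV_sum DERIV_cmult)
qed

text \<open>
  Where $\psi(z) > z \psi'(z)$, the cost is increasing in the noise level. Composed with the strictly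
  convex \<open>\<eta> j\<close> it is strictly convex in $n_j$, so that a critical point, where the derivative of the
  coordinate function does not point into the box, is the only minimizer.
\<close>

lemma critical_imp_strict_minimizer:
  assumes \<psi>: "convex_on UNIV \<psi>" "\<And>z. (\<psi> has_real_derivative \<psi>' z) (at z)"
    and slope: "\<And>z. z * \<psi>' z < \<psi> z"
    and crit: "critical \<psi> 0 x n" and "m \<in> box_set b" "m \<noteq> n"
  shows "objective \<psi> x n < objective \<psi> x m"
proof -
  have n: "n \<in> box_set b" using crit by (simp add: critical_def)
  let ?\<Delta> = "\<lambda>j. d $ j * (m $ j - n $ j) + (cost \<psi> x j (\<eta> j (m $ j)) - cost \<psi> x j (\<eta> j (n $ j)))"
  have pos: "0 < ?\<Delta> j" if "m $ j \<noteq> n $ j" for j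
  proof -
    define a t where "a = n $ j" and "t = m $ j"
    have in_box: "0 \<le> a" "a \<le> b" "0 \<le> t" "t \<le> b" "a \<noteq> t"
      using n \<open>m \<in> box_set b\<close> that by (auto simp: a_def t_def box_coord)
    have \<eta>a: "0 < \<eta> j a" "0 < \<eta> j t" using in_box by (auto intro: \<eta>_pos)
    define s where "s = (\<Sum>i\<in>UNIV. q i j * (\<psi> (g i j x / \<eta> j a) - g i j x / \<eta> j a * \<psi>' (g i j x / \<eta> j a)))"
    have loss_gap: "0 < \<psi> z - z * \<psi>' z" for z using slope[of z] by simp
    have "0 < s" unfolding s_def
      by (rule sum_pos[OF _ _ mult_pos_pos[OF q_pos loss_gap]]) auto
    have c_deriv: "(cost \<psi> x j has_real_derivative s) (at (\<eta> j a))"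
      unfolding s_def using \<psi>(2) \<eta>a(1) by (rule cost_has_derivative)
    define w where "w = \<eta>' j a"
    have "w < 0" unfolding w_def using in_box by (intro \<eta>'_neg)
    \<comment> \<open>The critical inequality along the segment from \<open>a\<close> to \<open>t\<close>, divided by the step length.\<close>
    have first_order: "0 \<le> (d $ j + s * w) * (t - a)"
    proof -
      let ?c = "\<lambda>u. cost \<psi> x j (\<eta> j u)"
      have "(?c has_real_derivative s * w) (at a within {0..})"
        unfolding w_def using c_deriv \<eta>_deriv in_box
        by (intro DERIV_chain2[where f = "cost \<psi> x j"]) auto
      then have c: "((\<lambda>u. (?c (a + u * (t - a)) - ?c a) / u) \<longlongrightarrow> s * w * (t - a)) (at_right 0)"
        using in_box by (intro segment_quotient_tendsto[where A = "{0..}" and f = ?c]) auto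
      have "((\<lambda>u. (\<eta> j (a + u * (t - a)) - \<eta> j a) / u) \<longlongrightarrow> w * (t - a)) (at_right 0)"
        unfolding w_def using in_box by (intro segment_quotient_tendsto[of "{0..}"] \<eta>_deriv) auto
      from tendsto_add[OF tendsto_mult_left[OF this, of "d $ j / w"] c]
      have "((\<lambda>u. d $ j / w * ((\<eta> j (a + u * (t - a)) - \<eta> j a) / u) + (?c (a + u * (t - a)) - ?c a) / u)
        \<longlongrightarrow> (d $ j + s * w) * (t - a)) (at_right 0)"
        using \<open>w < 0\<close> by (simp add: algebra_simps)
      then show ?thesis
      proof (rule tendsto_lowerbound)
        show "\<forall>\<^sub>F u in at_right 0. 0 \<le>
          d $ j / w * ((\<eta> j (a + u * (t - a)) - \<eta> j a) / u) + (?c (a + u * (t - a)) - ?c a) / u"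
        proof (rule eventually_mono[OF eventually_at_right_real[of 0 1]])
          fix u :: real assume u: "u \<in> {0<..<1}"
          have "(1 - u) *\<^sub>R a + u *\<^sub>R t \<in> {0..b}"
            using u in_box by (intro convexD) auto
          moreover have "(1 - u) *\<^sub>R a + u *\<^sub>R t = a + u * (t - a)" by (simp add: algebra_simps)
          ultimately have "0 \<le> d $ j / w * (\<eta> j (a + u * (t - a)) - \<eta> j a) + (?c (a + u * (t - a)) - ?c a)"
            using crit by (simp add: critical_def a_def w_def)
          then have "0 \<le> (d $ j / w * (\<eta> j (a + u * (t - a)) - \<eta> j a) + (?c (a + u * (t - a)) - ?c a)) / u"
            using u by simp
          then show "0 \<le>
            d $ j / w * ((\<eta> j (a + u * (t - a)) - \<eta> j a) / u) + (?c (a + u * (t - a)) - ?c a) / u"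
            by (simp add: add_divide_distrib)
        qed simp
      qed simp
    qed
    have "cost \<psi> x j (\<eta> j a) + s * (\<eta> j t - \<eta> j a) \<le> cost \<psi> x j (\<eta> j t)"
      using \<eta>a by (intro convex_above_tangent[OF cost_convex[OF \<psi>(1)]] has_field_derivative_at_within[OF c_deriv]) auto
    moreover have "s * (w * (t - a)) < s * (\<eta> j t - \<eta> j a)"
      using \<eta>_above_tangent[of a t j] in_box \<open>0 < s\<close> by (intro mult_strict_left_mono) (auto simp: w_def)
    ultimately show "0 < ?\<Delta> j"
      using first_order unfolding a_def[symmetric] t_def[symmetric] by (simp add: algebra_simps)
  qed
  obtain j where j: "m $ j \<noteq> n $ j" using \<open>m \<noteq> n\<close> by (auto simp: vec_eq_iff)
  have "0 < (\<Sum>j\<in>UNIV. ?\<Delta> j)"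
  proof (rule sum_pos2[of _ j])
    show "0 \<le> ?\<Delta> k" for k using pos[of k] by (cases "m $ k = n $ k") auto
  qed (use j pos in auto)
  then show ?thesis unfolding objective_diff[symmetric] by simp
qed

lemma local_minimizer_imp_stationary:
  assumes "n \<in> box_set b" "0 < \<epsilon>" "\<And>m. m \<in> box_set b \<Longrightarrow> norm (m - n) < \<epsilon> \<Longrightarrow> objective \<psi> x n \<le> objective \<psi> x m"
    and "x \<in> X" "is_arg_min (\<lambda>z. objective \<psi> z n) (\<lambda>z. z \<in> X) x"
  shows "(x, n) \<in> stationary \<psi>"
  using assms local_minimizer_imp_limiting_stationary[of n "box_set b" \<epsilon> "objective \<psi> x"]
  by (simp add: stationary_set_def)

lemma block_local_minimizers_subset_stationary:
  "block_local_minimizers X (box_set b) (objective \<psi>) \<subseteq> stationary \<psi>"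
  by (auto simp: block_local_minimizers_def intro!: local_minimizer_imp_stationary)

lemma stationary_eq_block_local_minimizers_of_growth:
  assumes "\<forall>(x, n)\<in>stationary \<psi>. local_quadratic_growth (box_set b) (objective \<psi> x) n"
  shows "stationary \<psi> = block_local_minimizers X (box_set b) (objective \<psi>)"
proof (rule antisym[OF _ block_local_minimizers_subset_stationary], rule subrelI)
  fix x n assume xn: "(x, n) \<in> stationary \<psi>"
  then obtain \<epsilon> c where "0 < \<epsilon>" "0 < c"
    and growth: "\<And>m. m \<in> box_set b \<Longrightarrow> norm (m - n) < \<epsilon> \<Longrightarrow>
      objective \<psi> x n + c / 2 * (norm (m - n))\<^sup>2 \<le> objective \<psi> x m"
    using assms by (fastforce simp: local_quadratic_growth_def)
  then have "objective \<psi> x n \<le> objective \<psi> x m" if "m \<in> box_set b" "norm (m - n) < \<epsilon>" for m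
    using growth[OF that] \<open>0 < c\<close> by (smt (verit) divide_pos_pos mult_nonneg_nonneg zero_le_power2)
  then show "(x, n) \<in> block_local_minimizers X (box_set b) (objective \<psi>)"
    using xn \<open>0 < \<epsilon>\<close> by (auto simp: stationary_set_def block_local_minimizers_def)
qed

end

section \<open>Stability of the stationary set\<close>

text \<open>
  The deterministic setting of the limit: $\psi$ plays the role of $\Psi$, with
  $\psi(z) - z \psi'(z) = \phi(z) > 0$, and $\psi_M$ that of the sample average.
\<close>

locale regular_sampling_limit = sampling_design +
  fixes \<psi> \<psi>' :: "real \<Rightarrow> real" and \<psi>s :: "nat \<Rightarrow> real \<Rightarrow> real"
  assumes \<psi>_convex: "convex_on UNIV \<psi>"
    and \<psi>_deriv: "\<And>z. (\<psi> has_real_derivative \<psi>' z) (at z)"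
    and \<psi>_slope: "\<And>z. z * \<psi>' z < \<psi> z"
    and \<psi>s_convex: "\<And>M. convex_on UNIV (\<psi>s M)"
    and \<psi>s_tendsto: "continuously_convergent \<psi>s \<psi>"
begin

lemma stationary_imp_strict_minimizer:
  assumes "(x, n) \<in> stationary \<psi>" "m \<in> box_set b" "m \<noteq> n"
  shows "objective \<psi> x n < objective \<psi> x m"
proof (rule critical_imp_strict_minimizer[OF \<psi>_convex \<psi>_deriv \<psi>_slope _ assms(2,3)])
  show "critical \<psi> 0 x n"
    using assms(1) by (intro stationary_imp_critical \<psi>_convex) (simp add: stationary_set_def)
qed

lemma stationary_eq_block_local_minimizers:
  "stationary \<psi> = block_local_minimizers X (box_set b) (objective \<psi>)"
proof (rule antisym[OF _ block_local_minimizers_subset_stationary], rule subrelI)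
  fix x n assume xn: "(x, n) \<in> stationary \<psi>"
  then have "objective \<psi> x n \<le> objective \<psi> x m" if "m \<in> box_set b" for m
    using stationary_imp_strict_minimizer[OF xn that] by (cases "m = n") auto
  then show "(x, n) \<in> block_local_minimizers X (box_set b) (objective \<psi>)"
    using xn by (auto simp: stationary_set_def block_local_minimizers_def intro!: exI[of _ 1])
qed

text \<open>
  $X$ is finite and each of its points carries at most one stationary $n$, the strict minimizer.
\<close>

lemma finite_stationary: "finite (stationary \<psi>)"
proof (rule finite_imageD)
  show "inj_on fst (stationary \<psi>)"
  proof (rule inj_onI)
    fix s t assume st: "s \<in> stationary \<psi>" "t \<in> stationary \<psi>" "fst s = fst t"
    obtain x n n' where eq: "s = (x, n)" "t = (x, n')"
      using st(3) by (cases s, cases t) auto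
    have "n \<in> box_set b" "n' \<in> box_set b" using st eq by (auto simp: stationary_set_def)
    then have "n = n'" using stationary_imp_strict_minimizer st eq by (metis less_asym)
    then show "s = t" by (simp add: eq)
  qed
  show "finite (fst ` stationary \<psi>)"
    by (rule finite_subset[OF _ finite_X]) (auto simp: stationary_set_def)
qed

text \<open>
  A limit point of stationary points is critical for $\psi$, since the critical inequality is closed
  under continuous convergence; it is therefore a minimizer and hence stationary. The minimality in
  $x$ passes to the limit as an inequality between objective values.
\<close>

lemma stationary_cluster:
  assumes k: "strict_mono (k :: nat \<Rightarrow> nat)" and y: "\<And>l. y l \<in> stationary (\<psi>s (k l))"
  shows "\<exists>k' l. strict_mono (k' :: nat \<Rightarrow> nat) \<and> l \<in> stationary \<psi> \<and> (y \<circ> k') \<longlonglongrightarrow> l"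
proof -
  have "seq_compact (X \<times> box_set b)"
    by (intro compact_imp_seq_compact compact_Times finite_imp_compact finite_X compact_box_set)
  moreover have "y l \<in> X \<times> box_set b" for l
    using y[of l] by (auto simp: stationary_set_def)
  ultimately obtain lim k' where lim: "lim \<in> X \<times> box_set b" and k': "strict_mono (k' :: nat \<Rightarrow> nat)"
    and y_lim: "(y \<circ> k') \<longlonglongrightarrow> lim"
    unfolding seq_compact_def by metis
  obtain x n where xn: "lim = (x, n)" by (cases lim)
  define xs ns where "xs l = fst (y (k' l))" and "ns l = snd (y (k' l))" for l
  have xs: "xs \<longlonglongrightarrow> x" and ns: "ns \<longlonglongrightarrow> n"
    using tendsto_fst[OF y_lim] tendsto_snd[OF y_lim] by (simp_all add: xn xs_def[abs_def] ns_def[abs_def] comp_def)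
  let ?\<psi> = "\<lambda>l. \<psi>s (k (k' l))"
  have conv: "continuously_convergent ?\<psi> \<psi>"
    using continuously_convergent_subseq[OF \<psi>s_tendsto strict_mono_o[OF k k']] by (simp add: comp_def)
  have stat: "(xs l, ns l) \<in> stationary (?\<psi> l)" for l
    using y[of "k' l"] by (simp add: xs_def ns_def)
  then have ns_box: "ns l \<in> box_set b" for l by (auto simp: stationary_set_def)
  have "critical (?\<psi> l) 0 (xs l) (ns l)" for l
    using stat[of l] by (intro stationary_imp_critical \<psi>s_convex) (simp add: stationary_set_def)
  then have crit: "critical \<psi> 0 x n"
    by (rule critical_limit[OF conv xs ns tendsto_const])
  have "(x, n) \<in> stationary \<psi>"
  proof (rule local_minimizer_imp_stationary[where \<epsilon> = 1])
    show "x \<in> X" "n \<in> box_set b" using lim xn by auto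
    show "objective \<psi> x n \<le> objective \<psi> x m" if "m \<in> box_set b" for m
      using critical_imp_strict_minimizer[OF \<psi>_convex \<psi>_deriv \<psi>_slope crit that] by (cases "m = n") auto
    have "objective \<psi> x n \<le> objective \<psi> z n" if "z \<in> X" for z
    proof (rule LIMSEQ_le)
      show "(\<lambda>l. objective (?\<psi> l) (xs l) (ns l)) \<longlonglongrightarrow> objective \<psi> x n"
        by (rule objective_tendsto[OF conv xs ns ns_box])
      show "(\<lambda>l. objective (?\<psi> l) z (ns l)) \<longlonglongrightarrow> objective \<psi> z n"
        by (rule objective_tendsto[OF conv tendsto_const ns ns_box])
      show "\<exists>N. \<forall>l\<ge>N. objective (?\<psi> l) (xs l) (ns l) \<le> objective (?\<psi> l) z (ns l)"
        using stat that by (auto simp: stationary_set_def is_arg_min_iff_le)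
    qed
    then show "is_arg_min (\<lambda>z. objective \<psi> z n) (\<lambda>z. z \<in> X) x"
      using \<open>x \<in> X\<close> by (simp add: is_arg_min_iff_le)
  qed simp
  then show ?thesis using k' y_lim xn by blast
qed

lemma excess_stationary_tendsto_0: "(\<lambda>M. excess_dist (stationary (\<psi>s M)) (stationary \<psi>)) \<longlonglongrightarrow> 0"
  by (rule excess_dist_tendsto_0I) (rule stationary_cluster)

text \<open>
  Every cluster point of the minimizers minimizes the limit objective, whose minimizer is unique.
\<close>

lemma minimizers_tendsto:
  assumes xn: "(x, n) \<in> stationary \<psi>" and ns_box: "\<And>M. ns M \<in> box_set b"
    and ns_min: "\<And>M m. m \<in> box_set b \<Longrightarrow> objective (\<psi>s M) x (ns M) \<le> objective (\<psi>s M) x m"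
  shows "ns \<longlonglongrightarrow> n"
proof (rule tendstoI, rule ccontr)
  fix \<epsilon> :: real assume "0 < \<epsilon>" "\<not> (\<forall>\<^sub>F M in sequentially. dist (ns M) n < \<epsilon>)"
  then obtain k :: "nat \<Rightarrow> nat" where k: "strict_mono k" "\<And>l. \<not> dist (ns (k l)) n < \<epsilon>"
    using not_eventually_imp_subseq by blast
  obtain n' k' where n': "n' \<in> box_set b" and k': "strict_mono (k' :: nat \<Rightarrow> nat)"
    and lim: "((\<lambda>l. ns (k l)) \<circ> k') \<longlonglongrightarrow> n'"
    using compact_imp_seq_compact[OF compact_box_set, of b] ns_box unfolding seq_compact_def by metis
  have conv: "continuously_convergent (\<lambda>l. \<psi>s (k (k' l))) \<psi>"
    using continuously_convergent_subseq[OF \<psi>s_tendsto strict_mono_o[OF k(1) k']] by (simp add: comp_def)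
  have n_box: "n \<in> box_set b" using xn by (simp add: stationary_set_def)
  have lim': "(\<lambda>l. ns (k (k' l))) \<longlonglongrightarrow> n'" using lim by (simp add: comp_def)
  have "objective \<psi> x n' \<le> objective \<psi> x n"
    by (rule LIMSEQ_le[OF objective_tendsto[OF conv tendsto_const lim' ns_box]
          objective_tendsto[OF conv tendsto_const tendsto_const n_box]])
      (use ns_min[OF n_box] in auto)
  then have "n' = n"
    using stationary_imp_strict_minimizer[OF xn n'] by force
  then have "\<forall>\<^sub>F l in sequentially. dist (ns (k (k' l))) n < \<epsilon>"
    using tendstoD[OF lim' \<open>0 < \<epsilon>\<close>] by simp
  then show False using k(2) by simp
qed

text \<open>
  A stationary pair $(x, n)$ is approximated by $(x, n_M)$ with $n_M$ a minimizer for the sample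
  objective at the same $x$. By uniqueness the finitely many other points of $X$ are worse than $x$ by a
  positive margin at $n$, hence still worse at $n_M$ for large $M$.
\<close>

lemma excess_stationary_limit_tendsto_0:
  assumes unique: "\<And>x n z. (x, n) \<in> stationary \<psi> \<Longrightarrow> is_arg_min (\<lambda>z. objective \<psi> z n) (\<lambda>z. z \<in> X) z \<Longrightarrow> z = x"
  shows "(\<lambda>M. excess_dist (stationary \<psi>) (stationary (\<psi>s M))) \<longlonglongrightarrow> 0"
proof (rule excess_dist_finite_tendsto_0I[OF finite_stationary], clarify)
  fix x n assume xn: "(x, n) \<in> stationary \<psi>"
  then have X: "x \<in> X" and n: "n \<in> box_set b" and
    x_min: "\<And>z. z \<in> X \<Longrightarrow> objective \<psi> x n \<le> objective \<psi> z n"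
    by (auto simp: stationary_set_def is_arg_min_iff_le)
  have "\<exists>m\<in>box_set b. \<forall>m'\<in>box_set b. objective (\<psi>s M) x m \<le> objective (\<psi>s M) x m'" for M
    using n by (intro continuous_attains_inf compact_box_set objective_continuous_on_box \<psi>s_convex) auto
  then obtain ns where ns_box: "\<And>M. ns M \<in> box_set b"
    and ns_min: "\<And>M m. m \<in> box_set b \<Longrightarrow> objective (\<psi>s M) x (ns M) \<le> objective (\<psi>s M) x m"
    by metis
  have ns: "ns \<longlonglongrightarrow> n" by (rule minimizers_tendsto[OF xn ns_box ns_min])
  have "\<forall>\<^sub>F M in sequentially. objective (\<psi>s M) x (ns M) \<le> objective (\<psi>s M) z (ns M)"
    if "z \<in> X" for z
  proof (cases "z = x")
    case False
    have "objective \<psi> x n < objective \<psi> z n"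
    proof (rule ccontr)
      assume "\<not> ?thesis"
      then have "is_arg_min (\<lambda>z. objective \<psi> z n) (\<lambda>z. z \<in> X) z"
        using x_min that by (force simp: is_arg_min_iff_le)
      then show False using unique[OF xn] False by blast
    qed
    then obtain c where c: "objective \<psi> x n < c" "c < objective \<psi> z n" using dense by blast
    have lim: "(\<lambda>M. objective (\<psi>s M) z' (ns M)) \<longlonglongrightarrow> objective \<psi> z' n" for z'
      by (rule objective_tendsto[OF \<psi>s_tendsto tendsto_const ns ns_box])
    from order_tendstoD(2)[OF lim c(1)] order_tendstoD(1)[OF lim c(2)] show ?thesis
      by eventually_elim simp
  qed simp
  then have "\<forall>\<^sub>F M in sequentially. \<forall>z\<in>X. objective (\<psi>s M) x (ns M) \<le> objective (\<psi>s M) z (ns M)"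
    using finite_X by (simp add: eventually_ball_finite)
  then have "\<forall>\<^sub>F M in sequentially. (x, ns M) \<in> stationary (\<psi>s M)"
    by eventually_elim
      (rule local_minimizer_imp_stationary[where \<epsilon> = 1], auto simp: is_arg_min_iff_le X ns_box ns_min)
  moreover have "(\<lambda>M. (x, ns M)) \<longlonglongrightarrow> (x, n)" by (intro tendsto_Pair tendsto_const ns)
  ultimately show "\<exists>y. y \<longlonglongrightarrow> (x, n) \<and> (\<forall>\<^sub>F M in sequentially. y M \<in> stationary (\<psi>s M))"
    by blast
qed

end

section \<open>The empirical loss and the sample average problem\<close>

definition empirical_Psi :: "(nat \<Rightarrow> real) \<Rightarrow> nat \<Rightarrow> real \<Rightarrow> real" where
  "empirical_Psi z M a = (\<Sum>t=1..M. max 0 (z t + a)) / real M"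

lemma convex_empirical_Psi: "convex_on UNIV (empirical_Psi z M)"
proof -
  have "convex_on UNIV (\<lambda>a. max 0 (c + a))" for c :: real
  proof (rule convex_onI)
    fix t a a' :: real assume t: "0 < t" "t < 1"
    have *: "0 \<le> (1 - t) * max 0 (c + a)" "0 \<le> t * max 0 (c + a')"
      "(1 - t) * (c + a) \<le> (1 - t) * max 0 (c + a)" "t * (c + a') \<le> t * max 0 (c + a')"
      using t by (auto intro!: mult_left_mono mult_nonneg_nonneg)
    have "c + ((1 - t) *\<^sub>R a + t *\<^sub>R a') = (1 - t) * (c + a) + t * (c + a')"
      by (simp add: algebra_simps)
    with * show "max 0 (c + ((1 - t) *\<^sub>R a + t *\<^sub>R a')) \<le> (1 - t) * max 0 (c + a) + t * max 0 (c + a')"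
      by linarith
  qed simp
  then have "convex_on UNIV (\<lambda>a. \<Sum>t\<in>T. max 0 (z t + a))" for T
    by (induction T rule: infinite_finite_induct) (auto intro!: convex_on_add simp: convex_on_const)
  then show ?thesis
    unfolding empirical_Psi_def by (intro convex_on_cdiv) auto
qed

lemma empirical_Psi_lipschitz: "\<bar>empirical_Psi z M a - empirical_Psi z M a'\<bar> \<le> \<bar>a - a'\<bar>"
proof (cases "M = 0")
  case False
  have "\<bar>(\<Sum>t=1..M. max 0 (z t + a)) - (\<Sum>t=1..M. max 0 (z t + a'))\<bar> \<le>
      (\<Sum>t=1..M. \<bar>max 0 (z t + a) - max 0 (z t + a')\<bar>)"
    unfolding sum_subtractf[symmetric] by (rule sum_abs)
  also have "\<dots> \<le> (\<Sum>t=1..M. \<bar>a - a'\<bar>)"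
    by (intro sum_mono) (auto simp: max_def)
  finally show ?thesis
    using False by (simp add: empirical_Psi_def diff_divide_distrib[symmetric] divide_le_eq mult.commute)
qed (simp add: empirical_Psi_def)

text \<open>
  A common Lipschitz constant upgrades convergence on a countable dense set to continuous
  convergence; countability is what allows a single exceptional null set.
\<close>

lemma continuously_convergent_of_lipschitz:
  assumes lip: "\<And>k a a'. \<bar>\<psi>s k a - \<psi>s k a'\<bar> \<le> \<bar>a - a'\<bar>"
    and lim: "\<And>\<rho>. \<rho> \<in> \<rat> \<Longrightarrow> (\<lambda>k. \<psi>s k \<rho>) \<longlonglongrightarrow> \<psi> \<rho>"
    and cont: "\<And>z. isCont \<psi> z"
  shows "continuously_convergent \<psi>s \<psi>"
  unfolding continuously_convergent_def
proof (intro allI impI tendstoI)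
  fix zs :: "nat \<Rightarrow> real" and z \<epsilon> :: real
  assume zs: "zs \<longlonglongrightarrow> z" and "0 < \<epsilon>"
  have "\<forall>\<epsilon>>0. \<exists>\<delta>>0. \<forall>a. dist a z < \<delta> \<longrightarrow> dist (\<psi> a) (\<psi> z) < \<epsilon>"
    using cont[of z] unfolding continuous_at_eps_delta .
  from this[rule_format, of "\<epsilon> / 4"] \<open>0 < \<epsilon>\<close>
  obtain \<delta> where "0 < \<delta>" and \<delta>: "\<And>a. dist a z < \<delta> \<Longrightarrow> dist (\<psi> a) (\<psi> z) < \<epsilon> / 4"
    by auto
  obtain \<rho> where \<rho>: "\<rho> \<in> \<rat>" "z < \<rho>" "\<rho> < z + min \<delta> (\<epsilon> / 4)"
    using Rats_dense_in_real[of z "z + min \<delta> (\<epsilon> / 4)"] \<open>0 < \<delta>\<close> \<open>0 < \<epsilon>\<close> by auto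
  then have \<rho>_near: "\<bar>\<rho> - z\<bar> < \<epsilon> / 4" by auto
  have \<psi>_near: "\<bar>\<psi> \<rho> - \<psi> z\<bar> < \<epsilon> / 4" using \<delta>[of \<rho>] \<rho> by (simp add: dist_real_def)
  have "\<forall>\<^sub>F k in sequentially. dist (zs k) z < \<epsilon> / 4"
    using tendstoD[OF zs, of "\<epsilon> / 4"] \<open>0 < \<epsilon>\<close> by simp
  moreover have "\<forall>\<^sub>F k in sequentially. dist (\<psi>s k \<rho>) (\<psi> \<rho>) < \<epsilon> / 4"
    using tendstoD[OF lim[OF \<rho>(1)], of "\<epsilon> / 4"] \<open>0 < \<epsilon>\<close> by simp
  ultimately show "\<forall>\<^sub>F k in sequentially. dist (\<psi>s k (zs k)) (\<psi> z) < \<epsilon>"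
  proof eventually_elim
    case (elim k)
    then show ?case
      using \<psi>_near lip[of k "zs k" \<rho>] \<rho>_near unfolding dist_real_def by linarith
  qed
qed

lemma (in prob_space) AE_empirical_Psi_tendsto:
  assumes indep: "indep_vars (\<lambda>_. borel) \<zeta> {1..}"
    and normal: "\<And>t. t \<ge> 1 \<Longrightarrow> distributed M lborel (\<zeta> t) std_normal_density"
  shows "AE \<omega> in M. (\<lambda>m. empirical_Psi (\<lambda>t. \<zeta> t \<omega>) m a) \<longlonglongrightarrow> Psi a"
  unfolding empirical_Psi_def
proof (rule strong_law_nonneg)
  let ?u = "\<lambda>s. max 0 (s + a)"
  show "indep_vars (\<lambda>_. borel) (\<lambda>t \<omega>. ?u (\<zeta> t \<omega>)) {1..}"
    by (rule indep_vars_compose2[OF indep]) simp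
  have bound: "integrable lborel (\<lambda>s. std_normal_density s * (?u s)\<^sup>2)"
  proof (rule Bochner_Integration.integrable_bound)
    show "integrable lborel (\<lambda>s. 2 * (std_normal_density s * s ^ 2) + 2 * a\<^sup>2 * (std_normal_density s * s ^ 0))"
      using integrable_std_normal_moment[of 2] integrable_std_normal_moment[of 0] by auto
    show "AE s in lborel. norm (std_normal_density s * (?u s)\<^sup>2) \<le>
        norm (2 * (std_normal_density s * s ^ 2) + 2 * a\<^sup>2 * (std_normal_density s * s ^ 0))"
    proof (rule AE_I2)
      fix s
      have "(?u s)\<^sup>2 \<le> (s + a)\<^sup>2" by (auto simp: max_def)
      also have "\<dots> \<le> 2 * s\<^sup>2 + 2 * a\<^sup>2" using sum_squares_bound[of s a] by (simp add: power2_sum)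
      finally have "std_normal_density s * (?u s)\<^sup>2 \<le> std_normal_density s * (2 * s\<^sup>2 + 2 * a\<^sup>2)"
        by (intro mult_left_mono) auto
      then show "norm (std_normal_density s * (?u s)\<^sup>2) \<le>
        norm (2 * (std_normal_density s * s ^ 2) + 2 * a\<^sup>2 * (std_normal_density s * s ^ 0))"
        by (simp add: algebra_simps)
    qed
  qed measurable
  show "integrable M (\<lambda>\<omega>. (?u (\<zeta> t \<omega>))\<^sup>2)" if "1 \<le> t" for t
    using bound distributed_integrable[OF normal[OF that], of "\<lambda>s. (?u s)\<^sup>2"] by simp
  show "expectation (\<lambda>\<omega>. ?u (\<zeta> t \<omega>)) = Psi a" if "1 \<le> t" for t
    using distributed_integral[OF normal[OF that], of ?u] expectation_positive_part_std_normal[of a] by simp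
  show "expectation (\<lambda>\<omega>. (?u (\<zeta> t \<omega>))\<^sup>2) \<le> (\<integral>s. std_normal_density s * (?u s)\<^sup>2 \<partial>lborel)" if "1 \<le> t" for t
    using distributed_integral[OF normal[OF that], of "\<lambda>s. (?u s)\<^sup>2"] by simp
qed simp

lemma (in prob_space) AE_empirical_Psi_continuously_convergent:
  assumes "indep_vars (\<lambda>_. borel) \<zeta> {1..}"
    and "\<And>t. t \<ge> 1 \<Longrightarrow> distributed M lborel (\<zeta> t) std_normal_density"
  shows "AE \<omega> in M. continuously_convergent (empirical_Psi (\<lambda>t. \<zeta> t \<omega>)) Psi"
proof -
  have "AE \<omega> in M. \<forall>\<rho>\<in>\<rat>. (\<lambda>m. empirical_Psi (\<lambda>t. \<zeta> t \<omega>) m \<rho>) \<longlonglongrightarrow> Psi \<rho>"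
    using AE_empirical_Psi_tendsto[OF assms] by (subst AE_ball_countable[OF countable_rat]) blast
  then show ?thesis
    by eventually_elim
      (intro continuously_convergent_of_lipschitz empirical_Psi_lipschitz DERIV_isCont[OF Psi_has_derivative]; blast)
qed

lemma (in sampling_design) sample_objective_eq:
  assumes "\<And>j m. \<eta> j m = h j m (\<sigma> j)"
  shows "sample_objective e d r q g h \<sigma> z M = objective (empirical_Psi z M)"
proof (intro ext)
  fix x n
  have "cost (empirical_Psi z M) x j y =
      1 / real M * (\<Sum>t=1..M. y * (\<Sum>i\<in>UNIV. q i j * max 0 (z t + g i j x / y)))" for j y
  proof -
    have "cost (empirical_Psi z M) x j y =
        (\<Sum>i\<in>UNIV. \<Sum>t=1..M. 1 / real M * (y * (q i j * max 0 (z t + g i j x / y))))"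
      by (simp add: cost_def empirical_Psi_def sum_distrib_left sum_divide_distrib)
    also have "\<dots> = (\<Sum>t=1..M. \<Sum>i\<in>UNIV. 1 / real M * (y * (q i j * max 0 (z t + g i j x / y))))"
      by (rule sum.swap)
    finally show ?thesis by (simp add: sum_distrib_left)
  qed
  then have "objective (empirical_Psi z M) x n = e + d \<bullet> n + r \<bullet> x +
      1 / real M * (\<Sum>j\<in>UNIV. \<Sum>t=1..M. \<eta> j (n $ j) *
        (\<Sum>i\<in>UNIV. q i j * max 0 (z t + g i j x / \<eta> j (n $ j))))"
    by (simp add: objective_def sum_distrib_left)
  also have "(\<Sum>j\<in>UNIV. \<Sum>t=1..M. \<eta> j (n $ j) *
        (\<Sum>i\<in>UNIV. q i j * max 0 (z t + g i j x / \<eta> j (n $ j)))) =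
      (\<Sum>t=1..M. \<Sum>j\<in>UNIV. \<eta> j (n $ j) *
        (\<Sum>i\<in>UNIV. q i j * max 0 (z t + g i j x / \<eta> j (n $ j))))"
    by (rule sum.swap)
  finally show "sample_objective e d r q g h \<sigma> z M x n = objective (empirical_Psi z M) x n"
    by (simp add: sample_objective_def assms[symmetric])
qed

lemma (in sampling_design) true_objective_eq:
  assumes "\<And>j m. \<eta> j m = h j m (\<sigma> j)"
  shows "true_objective e d r q g h \<sigma> = objective Psi"
  by (intro ext) (simp add: true_objective_def objective_def cost_def assms[symmetric])

lemma is_affine_function_imp_continuous:
  fixes f :: "'a::euclidean_space \<Rightarrow> real"
  assumes "is_affine_function f" shows "continuous_on A f"
proof -
  obtain l c where "linear l" "f = (\<lambda>x. l x + c)"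
    using assms by (auto simp: is_affine_function_def)
  moreover from \<open>linear l\<close> have "continuous_on A l"
    by (simp add: linear_continuous_on linear_conv_bounded_linear)
  ultimately show ?thesis by (simp add: continuous_on_add)
qed

theorem theorem5:
  fixes P :: "'w measure" and \<zeta> :: "nat \<Rightarrow> 'w \<Rightarrow> real"
    and p b e :: real
    and d :: "real ^ 'j::finite" and r :: "real ^ 'i::finite"
    and q :: "'i \<Rightarrow> 'j \<Rightarrow> real" and g :: "'i \<Rightarrow> 'j \<Rightarrow> real ^ 'i \<Rightarrow> real"
    and h :: "'j \<Rightarrow> real \<Rightarrow> real \<Rightarrow> real"
    and Sig :: "'j \<Rightarrow> real set" and \<sigma> :: "'j \<Rightarrow> real"
  assumes "prob_space P"
    and "prob_space.indep_vars P (\<lambda>_. borel) \<zeta> {1..}"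
    and "\<And>t. t \<ge> 1 \<Longrightarrow> distributed P lborel (\<zeta> t) std_normal_density"
    and "b > 0"
    and "\<And>i j. q i j > 0"
    and "\<And>i j. is_affine_function (g i j)"
    and "\<And>j. open (Sig j)"
    and "\<And>j. noise_function (Sig j) (h j)"
    and "\<And>j. \<sigma> j \<in> Sig j"
  shows
    "let X = binary_budget_set p;
         N = box_set b;
         F = true_objective e d r q g h \<sigma>;
         FM = (\<lambda>\<omega>. sample_objective e d r q g h \<sigma> (\<lambda>t. \<zeta> t \<omega>));
         S = stationary_set X N F;
         SM = (\<lambda>\<omega> M. stationary_set X N (FM \<omega> M))
     in AE \<omega> in P.
          ((\<forall>y. (\<forall>M\<ge>1. y M \<in> SM \<omega> M) \<longrightarrow>
                (\<exists>k l. strict_mono (k :: nat \<Rightarrow> nat) \<and> l \<in> S \<and> (y \<circ> k) \<longlonglongrightarrow> l)) \<and>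
           (\<lambda>M. excess_dist (SM \<omega> M) S) \<longlonglongrightarrow> 0) \<and>
          ((\<forall>(x, n)\<in>S. \<forall>z. is_arg_min (\<lambda>z. F z n) (\<lambda>z. z \<in> X) z \<longrightarrow> z = x) \<longrightarrow>
           (\<lambda>M. hausdorff_distance (SM \<omega> M) S) \<longlonglongrightarrow> 0) \<and>
          (\<forall>M\<ge>1.
             (\<forall>(x, n)\<in>SM \<omega> M. local_quadratic_growth N (FM \<omega> M x) n) \<longrightarrow>
             S = block_local_minimizers X N F \<and>
             SM \<omega> M = block_local_minimizers X N (FM \<omega> M))"
proof -
  interpret prob_space P by fact
  define \<eta> where "\<eta> j m = h j m (\<sigma> j)" for j m
  have noise: "(\<forall>n\<ge>0. 0 < \<eta> j n) \<and> strictly_convex_on {0..} (\<eta> j) \<and> antimono_on {0..} (\<eta> j) \<and>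
      (\<exists>h'. continuous_on {0..} h' \<and> (\<forall>n\<ge>0. (\<eta> j has_real_derivative h' n) (at n within {0..})))" for j
    using assms(8)[of j] assms(9)[of j] unfolding noise_function_def \<eta>_def by blast
  then obtain \<eta>' where \<eta>': "\<And>j. continuous_on {0..} (\<eta>' j)"
    "\<And>j n. 0 \<le> n \<Longrightarrow> (\<eta> j has_real_derivative \<eta>' j n) (at n within {0..})"
    by metis
  define X :: "(real ^ 'i) set" where "X = binary_budget_set p"
  interpret D: sampling_design X b e d r q g \<eta> \<eta>'
  proof
    show "finite X" unfolding X_def by (rule finite_binary_budget_set)
    show "continuous_on UNIV (g i j)" for i j
      using assms(6) by (rule is_affine_function_imp_continuous)
  qed (use noise \<eta>' assms(5) in auto)
  have slope: "z * std_normal_cdf z < Psi z" for z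
    by (simp add: Psi_def normal_density_pos)
  note F_eq = D.true_objective_eq[of h \<sigma>, OF \<eta>_def] and FM_eq = D.sample_objective_eq[of h \<sigma>, OF \<eta>_def]
  have "AE \<omega> in P. continuously_convergent (empirical_Psi (\<lambda>t. \<zeta> t \<omega>)) Psi"
    using assms(2,3) by (rule AE_empirical_Psi_continuously_convergent)
  then show ?thesis
    unfolding Let_def F_eq FM_eq X_def[symmetric]
  proof eventually_elim
    case (elim \<omega>)
    let ?\<psi> = "empirical_Psi (\<lambda>t. \<zeta> t \<omega>)"
    interpret regular_sampling_limit X b e d r q g \<eta> \<eta>' Psi std_normal_cdf ?\<psi>
      by unfold_locales (use elim slope in \<open>auto intro: convex_Psi Psi_has_derivative convex_empirical_Psi\<close>)
    show ?case
    proof (intro conjI allI impI)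
      fix y assume y: "\<forall>M\<ge>1. y M \<in> D.stationary (?\<psi> M)"
      \<comment> \<open>Nothing is known about \<open>y 0\<close>, so the sequence is shifted by one.\<close>
      have "strict_mono Suc" by (simp add: strict_mono_Suc_iff)
      then obtain k l where "strict_mono (k :: nat \<Rightarrow> nat)" "l \<in> D.stationary Psi" "((y \<circ> Suc) \<circ> k) \<longlonglongrightarrow> l"
        using stationary_cluster[of Suc "y \<circ> Suc"] y by auto
      then show "\<exists>k l. strict_mono (k :: nat \<Rightarrow> nat) \<and> l \<in> D.stationary Psi \<and> (y \<circ> k) \<longlonglongrightarrow> l"
        using \<open>strict_mono Suc\<close> by (metis comp_assoc strict_mono_o)
    next
      show "(\<lambda>M. excess_dist (D.stationary (?\<psi> M)) (D.stationary Psi)) \<longlonglongrightarrow> 0"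
        by (rule excess_stationary_tendsto_0)
    next
      assume "\<forall>(x, n)\<in>D.stationary Psi.
        \<forall>z. is_arg_min (\<lambda>z. D.objective Psi z n) (\<lambda>z. z \<in> X) z \<longrightarrow> z = x"
      then have "(\<lambda>M. excess_dist (D.stationary Psi) (D.stationary (?\<psi> M))) \<longlonglongrightarrow> 0"
        by (intro excess_stationary_limit_tendsto_0) blast
      from tendsto_max[OF this excess_stationary_tendsto_0]
      show "(\<lambda>M. hausdorff_distance (D.stationary (?\<psi> M)) (D.stationary Psi)) \<longlonglongrightarrow> 0"
        by (simp add: hausdorff_distance_def)
    next
      show "D.stationary Psi = block_local_minimizers X (box_set b) (D.objective Psi)"
        by (rule stationary_eq_block_local_minimizers)
    next
      fix M assume "\<forall>(x, n)\<in>D.stationary (?\<psi> M). local_quadratic_growth (box_set b) (D.objective (?\<psi> M) x) n"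
      then show "D.stationary (?\<psi> M) = block_local_minimizers X (box_set b) (D.objective (?\<psi> M))"
        by (rule D.stationary_eq_block_local_minimizers_of_growth)
    qed
  qed
qed

end
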